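(* Let $\mathbb{K}$ be an algebraically closed field of characteristic zero and let $B=\bigoplus_{i\ge 0}B_{(i)}$ be a finite-dimensional graded bialgebra over $\mathbb{K}$. If $B$ is rigid and coradically-graded, then $B$ is graded-rigid.
   Context: Rigid: for $n\ge 1$, $\mathrm{Bialg}_n$ denotes the affine variety of all bialgebra structures (multiplication, unit, comultiplication, counit, given by structure constants) on a fixed $n$-dimensional $\mathbb{K}$-space, with the natural $GL_n(\mathbb{K})$-action by base change, so that orbits correspond to isomorphism classes of $n$-dimensional bialgebras. An $n$-dimensional bialgebra $B$ is called rigid if the $GL_n(\mathbb{K})$-orbit in $\mathrm{Bialg}_n$ containing $B$ is Zariski open. Coradically-graded: the coradical filtration of $B$ is $B_n=\bigoplus_{i\le n}B_{(i)}$, $n\ge 0$. Graded-rigid: let $m,\Delta,\varepsilon,1_B$ be the structure maps of $B$ (homogeneous of degree $0$). View $B[t]$ as a free $\mathbb{K}[t]$-module and as a graded $\mathbb{K}$-space with $\deg t=1$ and $\deg b=n$ for $b\in B_{(n)}$. A (graded bialgebra) deformation $(B[t],m_t,\Delta_t)$ of $B$ consists of $\mathbb{K}[t]$-linear maps, homogeneous of degree zero, $m_t:(B\otimes B)[t]\to B[t]$ and $\Delta_t:B[t]\to(B\otimes B)[t]\cong B[t]\otimes_{\mathbb{K}[t]}B[t]$ such that (i) $B[t]$ is a bialgebra over $\mathbb{K}[t]$ with identity $1_B$, multiplication $m_t$, counit $\varepsilon_t$ given by $\varepsilon_t(bt^j)=\varepsilon(b)t^j$, and comultiplication $\Delta_t$;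 (ii) $m_t\equiv m\otimes\mathrm{Id}_{\mathbb{K}[t]}$ and $\Delta_t\equiv\Delta\otimes\mathrm{Id}_{\mathbb{K}[t]}$ mod $(t)$. Two deformations are isomorphic if there is an isomorphism $\phi$ of $\mathbb{K}[t]$-bialgebras between them which is homogeneous of degree zero and satisfies $\phi\equiv\mathrm{Id}_B\otimes\mathrm{Id}_{\mathbb{K}[t]}$ mod $(t)$. $B$ is graded-rigid if the set of isomorphism classes of deformations has only one element, i.e. every deformation is isomorphic to the trivial one. *)

theory Defs
  imports
    "HOL-Analysis.Analysis"
    "HOL-Computational_Algebra.Polynomial"
    "HOL-Library.Poly_Mapping"
begin

text \<open>
  Free modules of finite rank over a commutative ring \<open>'r\<close> are given as coordinate modules
  \<open>'r ^ 'i\<close>, and the tensor product of \<open>'r ^ 'i\<close> and \<open>'r ^ 'j\<close> is \<open>'r ^ ('i \<times> 'j)\<close>, the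
  standard basis being \<open>e\<^sub>i \<otimes> e\<^sub>j\<close>. For \<open>B = 'k ^ 'n\<close> we thereby have \<open>B[t] = ('k poly) ^ 'n\<close> and
  \<open>(B \<otimes> B)[t] = ('k poly) ^ ('n \<times> 'n) = B[t] \<otimes> B[t]\<close>, the last tensor product being over \<open>'k[t]\<close>.
\<close>

section \<open>Tensor products of coordinate modules\<close>

definition tens :: "'r::comm_ring_1 ^ 'i::finite \<Rightarrow> 'r ^ 'j::finite \<Rightarrow> 'r ^ ('i \<times> 'j)"  (infixr \<open>\<otimes>\<^sub>v\<close> 75)
  where "v \<otimes>\<^sub>v w = (\<chi> p. v $ fst p * w $ snd p)"

text \<open>The map \<open>f \<otimes> g\<close> for linear \<open>f\<close> and \<open>g\<close>.\<close>

definition tensor_map ::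
    "('r::comm_ring_1 ^ 'a::finite \<Rightarrow> 'r ^ 'c::finite) \<Rightarrow> ('r ^ 'b::finite \<Rightarrow> 'r ^ 'd::finite) \<Rightarrow>
     'r ^ ('a \<times> 'b) \<Rightarrow> 'r ^ ('c \<times> 'd)"
  where "tensor_map f g x = (\<Sum>(i, j)\<in>UNIV. (x $ (i, j)) *s (f (axis i 1) \<otimes>\<^sub>v g (axis j 1)))"

text \<open>\<open>f \<otimes> id\<close> and \<open>id \<otimes> f\<close> for a linear functional \<open>f\<close>, followed by \<open>R \<otimes> V \<cong> V \<cong> V \<otimes> R\<close>.\<close>

definition contract_left ::
    "('r::comm_ring_1 ^ 'a::finite \<Rightarrow> 'r) \<Rightarrow> 'r ^ ('a::finite \<times> 'b::finite) \<Rightarrow> 'r ^ 'b"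
  where "contract_left f x = (\<Sum>(i, j)\<in>UNIV. (x $ (i, j) * f (axis i 1)) *s axis j 1)"

definition contract_right ::
    "('r::comm_ring_1 ^ 'b::finite \<Rightarrow> 'r) \<Rightarrow> 'r ^ ('a::finite \<times> 'b::finite) \<Rightarrow> 'r ^ 'a"
  where "contract_right f x = (\<Sum>(i, j)\<in>UNIV. (x $ (i, j) * f (axis j 1)) *s axis i 1)"

text \<open>\<open>(u \<otimes> v) \<otimes> w \<mapsto> u \<otimes> (v \<otimes> w)\<close>\<close>

definition tensor_assoc ::
    "'r::comm_ring_1 ^ (('a::finite \<times> 'b::finite) \<times> 'c::finite) \<Rightarrow> 'r ^ ('a \<times> ('b \<times> 'c))"
  where "tensor_assoc x = (\<chi> p. case p of (i, j, k) \<Rightarrow> x $ ((i, j), k))"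

text \<open>\<open>(u \<otimes> v) \<otimes> (w \<otimes> z) \<mapsto> (u \<otimes> w) \<otimes> (v \<otimes> z)\<close>\<close>

definition middle_swap ::
    "'r::comm_ring_1 ^ (('a::finite \<times> 'b::finite) \<times> ('c::finite \<times> 'd::finite)) \<Rightarrow>
     'r ^ (('a \<times> 'c) \<times> ('b \<times> 'd))"
  where "middle_swap x = (\<chi> p. case p of ((i, k), (j, l)) \<Rightarrow> x $ ((i, j), (k, l)))"

section \<open>Bialgebras\<close>

record ('r, 'n::finite) bialg =
  bmult :: "'r ^ ('n \<times> 'n) \<Rightarrow> 'r ^ 'n"
  bone :: "'r ^ 'n"
  bcomult :: "'r ^ 'n \<Rightarrow> 'r ^ ('n \<times> 'n)"
  bcounit :: "'r ^ 'n \<Rightarrow> 'r"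

definition bialgebra :: "('r::comm_ring_1, 'n::finite) bialg \<Rightarrow> bool"
  where "bialgebra B \<longleftrightarrow>
    module_hom (*s) (*s) (bmult B) \<and>
    module_hom (*s) (*s) (bcomult B) \<and>
    module_hom (*s) (*) (bcounit B) \<and>
    (\<forall>a b c. bmult B (bmult B (a \<otimes>\<^sub>v b) \<otimes>\<^sub>v c) = bmult B (a \<otimes>\<^sub>v bmult B (b \<otimes>\<^sub>v c))) \<and>
    (\<forall>a. bmult B (bone B \<otimes>\<^sub>v a) = a \<and> bmult B (a \<otimes>\<^sub>v bone B) = a) \<and>
    (\<forall>a. tensor_assoc (tensor_map (bcomult B) id (bcomult B a)) =
         tensor_map id (bcomult B) (bcomult B a)) \<and>
    (\<forall>a. contract_left (bcounit B) (bcomult B a) = a \<and>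
         contract_right (bcounit B) (bcomult B a) = a) \<and>
    (\<forall>a b. bcomult B (bmult B (a \<otimes>\<^sub>v b)) =
         tensor_map (bmult B) (bmult B) (middle_swap (bcomult B a \<otimes>\<^sub>v bcomult B b))) \<and>
    bcomult B (bone B) = bone B \<otimes>\<^sub>v bone B \<and>
    (\<forall>a b. bcounit B (bmult B (a \<otimes>\<^sub>v b)) = bcounit B a * bcounit B b) \<and>
    bcounit B (bone B) = 1"

definition bialgebra_iso ::
    "('r::comm_ring_1 ^ 'n::finite \<Rightarrow> 'r ^ 'n) \<Rightarrow> ('r, 'n) bialg \<Rightarrow> ('r, 'n) bialg \<Rightarrow> bool"
  where "bialgebra_iso \<phi> A B \<longleftrightarrow>
    module_hom (*s) (*s) \<phi> \<and> bij \<phi> \<and>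
    (\<forall>a b. \<phi> (bmult A (a \<otimes>\<^sub>v b)) = bmult B (\<phi> a \<otimes>\<^sub>v \<phi> b)) \<and>
    \<phi> (bone A) = bone B \<and>
    (\<forall>a. bcomult B (\<phi> a) = tensor_map \<phi> \<phi> (bcomult A a)) \<and>
    (\<forall>a. bcounit B (\<phi> a) = bcounit A a)"

section \<open>The variety of bialgebra structures and rigidity\<close>

type_synonym ('v, 'k) mpoly = "('v \<Rightarrow>\<^sub>0 nat) \<Rightarrow>\<^sub>0 'k"

definition eval_mpoly :: "('v \<Rightarrow> 'k::comm_ring_1) \<Rightarrow> ('v, 'k) mpoly \<Rightarrow> 'k"
  where "eval_mpoly x p =
    (\<Sum>m\<in>Poly_Mapping.keys p. Poly_Mapping.lookup p m *
      (\<Prod>v\<in>Poly_Mapping.keys m. x v ^ Poly_Mapping.lookup m v))"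

definition zariski_closed :: "('v \<Rightarrow> 'k::field) set \<Rightarrow> bool"
  where "zariski_closed Z \<longleftrightarrow> (\<exists>P :: ('v, 'k) mpoly set. Z = {x. \<forall>p\<in>P. eval_mpoly x p = 0})"

text \<open>\<open>U\<close> is open in the subspace topology induced on \<open>X\<close>.\<close>

definition zariski_open_in :: "('v \<Rightarrow> 'k::field) set \<Rightarrow> ('v \<Rightarrow> 'k) set \<Rightarrow> bool"
  where "zariski_open_in X U \<longleftrightarrow> (\<exists>Z. zariski_closed Z \<and> U = X - Z)"

datatype 'n coord = MultC 'n 'n 'n | OneC 'n | ComultC 'n 'n 'n | CounitC 'n

fun struct_consts :: "('k::field, 'n::finite) bialg \<Rightarrow> 'n coord \<Rightarrow> 'k"
  where
    "struct_consts B (MultC i j k) = bmult B (axis i 1 \<otimes>\<^sub>v axis j 1) $ k"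
  | "struct_consts B (OneC i) = bone B $ i"
  | "struct_consts B (ComultC i j k) = bcomult B (axis i 1) $ (j, k)"
  | "struct_consts B (CounitC i) = bcounit B (axis i 1)"

definition Bialg :: "('n::finite coord \<Rightarrow> 'k::field) set"
  where "Bialg = struct_consts ` {B. bialgebra B}"

text \<open>The structure obtained from \<open>B\<close> by the base change \<open>A \<in> GL\<^sub>n\<close>.\<close>

definition base_change :: "'k::field ^ 'n ^ 'n \<Rightarrow> ('k, 'n::finite) bialg \<Rightarrow> ('k, 'n) bialg"
  where "base_change A B = (let g = (*v) A; h = (*v) (matrix_inv A) in
    \<lparr> bmult = (\<lambda>x. g (bmult B (tensor_map h h x))),
      bone = g (bone B),
      bcomult = (\<lambda>v. tensor_map g g (bcomult B (h v))),
      bcounit = (\<lambda>v. bcounit B (h v)) \<rparr>)"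

definition GL_orbit :: "('k::field, 'n::finite) bialg \<Rightarrow> ('k, 'n) bialg set"
  where "GL_orbit B = {base_change A B |A. invertible A}"

definition rigid :: "('k::field, 'n::finite) bialg \<Rightarrow> bool"
  where "rigid B \<longleftrightarrow> zariski_open_in Bialg (struct_consts ` GL_orbit B)"

section \<open>Graded bialgebras\<close>

definition is_grading :: "(nat \<Rightarrow> ('k::field ^ 'n::finite) set) \<Rightarrow> bool"
  where "is_grading G \<longleftrightarrow>
    (\<forall>i. vec.subspace (G i)) \<and>
    (\<forall>v. \<exists>!c. (\<forall>i. c i \<in> G i) \<and> finite {i. c i \<noteq> 0} \<and> v = (\<Sum>i | c i \<noteq> 0. c i))"

definition tensor_subspace ::
    "('k::field ^ 'a::finite) set \<Rightarrow> ('k ^ 'b::finite) set \<Rightarrow> ('k ^ ('a \<times> 'b)) set"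
  where "tensor_subspace V W = vec.span {v \<otimes>\<^sub>v w |v w. v \<in> V \<and> w \<in> W}"

definition tensor_grading ::
    "(nat \<Rightarrow> ('k::field ^ 'n::finite) set) \<Rightarrow> nat \<Rightarrow> ('k ^ ('n \<times> 'n)) set"
  where "tensor_grading G d = vec.span (\<Union>i\<le>d. tensor_subspace (G i) (G (d - i)))"

definition graded_bialgebra ::
    "(nat \<Rightarrow> ('k::field ^ 'n::finite) set) \<Rightarrow> ('k, 'n) bialg \<Rightarrow> bool"
  where "graded_bialgebra G B \<longleftrightarrow>
    bialgebra B \<and> is_grading G \<and>
    (\<forall>d. bmult B ` tensor_grading G d \<subseteq> G d) \<and>
    bone B \<in> G 0 \<and>
    (\<forall>d. bcomult B ` G d \<subseteq> tensor_grading G d) \<and>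
    (\<forall>d>0. bcounit B ` G d \<subseteq> {0})"

section \<open>The coradical filtration\<close>

definition subcoalgebra :: "('k::field, 'n::finite) bialg \<Rightarrow> ('k ^ 'n) set \<Rightarrow> bool"
  where "subcoalgebra B D \<longleftrightarrow> vec.subspace D \<and> bcomult B ` D \<subseteq> tensor_subspace D D"

definition simple_subcoalgebra :: "('k::field, 'n::finite) bialg \<Rightarrow> ('k ^ 'n) set \<Rightarrow> bool"
  where "simple_subcoalgebra B D \<longleftrightarrow>
    subcoalgebra B D \<and> D \<noteq> {0} \<and> (\<forall>E. subcoalgebra B E \<and> E \<subseteq> D \<longrightarrow> E = {0} \<or> E = D)"

definition coradical :: "('k::field, 'n::finite) bialg \<Rightarrow> ('k ^ 'n) set"
  where "coradical B = vec.span (\<Union>{D. simple_subcoalgebra B D})"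

fun coradical_filtration :: "('k::field, 'n::finite) bialg \<Rightarrow> nat \<Rightarrow> ('k ^ 'n) set"
  where
    "coradical_filtration B 0 = coradical B"
  | "coradical_filtration B (Suc d) =
      {v. bcomult B v \<in> vec.span
            (tensor_subspace UNIV (coradical_filtration B d) \<union> tensor_subspace (coradical B) UNIV)}"

definition coradically_graded ::
    "(nat \<Rightarrow> ('k::field ^ 'n::finite) set) \<Rightarrow> ('k, 'n) bialg \<Rightarrow> bool"
  where "coradically_graded G B \<longleftrightarrow> (\<forall>d. coradical_filtration B d = vec.span (\<Union>i\<le>d. G i))"

section \<open>Graded deformations and graded rigidity\<close>

definition const_vec :: "'k::comm_ring_1 ^ 'i::finite \<Rightarrow> 'k poly ^ 'i"
  where "const_vec v = (\<chi> i. [:v $ i:])"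

text \<open>Extension of scalars \<open>f \<otimes> id\<close> from \<open>'k\<close> to \<open>'k[t]\<close>, for linear maps and linear functionals.\<close>

definition ext_map :: "('k::comm_ring_1 ^ 'i::finite \<Rightarrow> 'k ^ 'j::finite) \<Rightarrow> 'k poly ^ 'i \<Rightarrow> 'k poly ^ 'j"
  where "ext_map f v = (\<Sum>i\<in>UNIV. (v $ i) *s const_vec (f (axis i 1)))"

definition ext_functional :: "('k::comm_ring_1 ^ 'i::finite \<Rightarrow> 'k) \<Rightarrow> 'k poly ^ 'i \<Rightarrow> 'k poly"
  where "ext_functional f v = (\<Sum>i\<in>UNIV. v $ i * [:f (axis i 1):])"

text \<open>The degree \<open>d\<close> component of \<open>V[t]\<close> for a graded space \<open>V\<close>, where \<open>t\<close> has degree 1.\<close>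

definition poly_grading ::
    "(nat \<Rightarrow> ('k::field ^ 'i::finite) set) \<Rightarrow> nat \<Rightarrow> ('k poly ^ 'i) set"
  where "poly_grading G d =
    {(\<Sum>j\<le>d. monom 1 j *s const_vec (b j)) |b. \<forall>j\<le>d. b j \<in> G (d - j)}"

definition homogeneous0 :: "(nat \<Rightarrow> 'a set) \<Rightarrow> (nat \<Rightarrow> 'b set) \<Rightarrow> ('a \<Rightarrow> 'b) \<Rightarrow> bool"
  where "homogeneous0 G H f \<longleftrightarrow> (\<forall>d. f ` G d \<subseteq> H d)"

definition eq_mod_t :: "('a \<Rightarrow> 'k::comm_ring_1 poly ^ 'j::finite) \<Rightarrow> ('a \<Rightarrow> 'k poly ^ 'j) \<Rightarrow> bool"
  where "eq_mod_t f g \<longleftrightarrow> (\<forall>x. \<exists>y. f x - g x = monom 1 1 *s y)"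

text \<open>The \<open>'k[t]\<close>-bialgebra structure on \<open>B[t]\<close> given by \<open>m\<^sub>t\<close> and \<open>\<Delta>\<^sub>t\<close>; unit and counit come from \<open>B\<close>.\<close>

definition deformed ::
    "('k::field, 'n::finite) bialg \<Rightarrow> ('k poly ^ ('n \<times> 'n) \<Rightarrow> 'k poly ^ 'n) \<Rightarrow>
     ('k poly ^ 'n \<Rightarrow> 'k poly ^ ('n \<times> 'n)) \<Rightarrow> ('k poly, 'n) bialg"
  where "deformed B mt Dt =
    \<lparr> bmult = mt, bone = const_vec (bone B), bcomult = Dt, bcounit = ext_functional (bcounit B) \<rparr>"

definition deformation ::
    "(nat \<Rightarrow> ('k::field ^ 'n::finite) set) \<Rightarrow> ('k, 'n) bialg \<Rightarrow>
     ('k poly ^ ('n \<times> 'n) \<Rightarrow> 'k poly ^ 'n) \<Rightarrow> ('k poly ^ 'n \<Rightarrow> 'k poly ^ ('n \<times> 'n)) \<Rightarrow> bool"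
  where "deformation G B mt Dt \<longleftrightarrow>
    bialgebra (deformed B mt Dt) \<and>
    homogeneous0 (poly_grading (tensor_grading G)) (poly_grading G) mt \<and>
    homogeneous0 (poly_grading G) (poly_grading (tensor_grading G)) Dt \<and>
    eq_mod_t mt (ext_map (bmult B)) \<and>
    eq_mod_t Dt (ext_map (bcomult B))"

definition deformation_iso ::
    "(nat \<Rightarrow> ('k::field ^ 'n::finite) set) \<Rightarrow> ('k, 'n) bialg \<Rightarrow>
     (('k poly ^ ('n \<times> 'n) \<Rightarrow> 'k poly ^ 'n) \<times> ('k poly ^ 'n \<Rightarrow> 'k poly ^ ('n \<times> 'n))) \<Rightarrow>
     (('k poly ^ ('n \<times> 'n) \<Rightarrow> 'k poly ^ 'n) \<times> ('k poly ^ 'n \<Rightarrow> 'k poly ^ ('n \<times> 'n))) \<Rightarrow> bool"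
  where "deformation_iso G B = (\<lambda>(mt, Dt) (mt', Dt'). \<exists>\<phi>.
    bialgebra_iso \<phi> (deformed B mt Dt) (deformed B mt' Dt') \<and>
    homogeneous0 (poly_grading G) (poly_grading G) \<phi> \<and>
    eq_mod_t \<phi> id)"

text \<open>Exactly one isomorphism class; as the trivial deformation is a deformation, it is its class.\<close>

definition graded_rigid ::
    "(nat \<Rightarrow> ('k::field ^ 'n::finite) set) \<Rightarrow> ('k, 'n) bialg \<Rightarrow> bool"
  where "graded_rigid G B \<longleftrightarrow>
    is_singleton ({(mt, Dt). deformation G B mt Dt} //
      {(d, d'). case_prod (deformation G B) d \<and> case_prod (deformation G B) d' \<and>
         deformation_iso G B d d'})"

end

theory Submission
  imports Defs
begin

text \<open>
  Write \<open>F\<^sub>d\<close> for the sum of the \<open>G i\<close> with \<open>i \<le> d\<close>, and let \<open>U\<close> be the fibre of a deformation of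
  \<open>B\<close> over \<open>t = 1\<close>. By homogeneity a deformation is the same as a filtered bialgebra \<open>U\<close> whose
  associated graded bialgebra is \<open>B\<close>: the structure maps at \<open>t = l \<noteq> 0\<close> are those of \<open>U\<close> conjugated
  by the map \<open>scaling l\<close>, which multiplies by \<open>l\<^sup>d\<close> in degree \<open>d\<close> (\<open>fibre_scaling_iso\<close>), and at
  \<open>t = 0\<close> they are those of \<open>B\<close>.

  The fibres form a polynomial curve in the variety of bialgebra structures that passes through
  \<open>B\<close> at \<open>t = 0\<close>. The orbit of \<open>B\<close> is open, so the curve lies in it for almost all \<open>t\<close>
  (\<open>rigid_generic_fibre\<close>), and by scaling there is an isomorphism \<open>f : U \<rightarrow> B\<close>.

  Such an \<open>f\<close> maps the coradical filtration of \<open>U\<close> to that of \<open>B\<close>, which is \<open>F\<close>. In degree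
  \<open>0\<close> nothing is deformed, so the simple subcoalgebras of \<open>B\<close> are still simple subcoalgebras of
  \<open>U\<close>; together with \<open>\<Delta> F\<^sub>d \<subseteq> \<Sum> F\<^sub>a \<otimes> F\<^sub>d\<^sub>-\<^sub>a\<close> this puts \<open>F\<^sub>d\<close> inside the \<open>d\<close>th step of the coradical
  filtration of \<open>U\<close> (\<open>filtration_le_coradical_filtration\<close>). Hence \<open>f F\<^sub>d \<subseteq> F\<^sub>d\<close>, so \<open>f\<close> is an
  isomorphism of filtered bialgebras.

  A filtered linear map is a sum of parts that lower the degree by \<open>j \<ge> 0\<close>; giving the \<open>j\<close>th part
  the factor \<open>t ^ j\<close> yields a homogeneous \<open>'k[t]\<close>-linear map, its homogenisation. For a filtered
  isomorphism of fibres over \<open>t = 1\<close> this is an isomorphism of the deformations themselves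
  (\<open>homogenize_iso\<close>), because at \<open>t = l \<noteq> 0\<close> it is a conjugate of the given map by scalings, and
  identities over \<open>'k[t]\<close> may be tested at infinitely many values of \<open>t\<close>. At \<open>t = 0\<close> it becomes the
  associated graded map \<open>gr f\<close>, an automorphism of \<open>B\<close>. Replacing \<open>f\<close> by \<open>(gr f)\<^sup>-\<^sup>1 \<circ> f\<close> makes the
  associated graded map the identity (\<open>normalized_fibre_iso\<close>). For two deformations with such
  normalised isomorphisms \<open>f\<close> and \<open>f'\<close>, the homogenisation of \<open>f'\<^sup>-\<^sup>1 \<circ> f\<close> is an isomorphism of
  deformations that is the identity modulo \<open>t\<close>.
\<close>

section \<open>Linear maps between coordinate modules\<close>

abbreviation linear_map :: "('r::comm_ring_1 ^ 'i::finite \<Rightarrow> 'r ^ 'j::finite) \<Rightarrow> bool"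
  where "linear_map \<equiv> module_hom (*s) (*s)"

abbreviation linear_functional :: "('r::comm_ring_1 ^ 'i::finite \<Rightarrow> 'r) \<Rightarrow> bool"
  where "linear_functional \<equiv> module_hom (*s) (*)"

lemma module_vec: "module ((*s) :: 'r::comm_ring_1 \<Rightarrow> 'r ^ 'i::finite \<Rightarrow> 'r ^ 'i)"
  by unfold_locales (auto simp: vec_eq_iff algebra_simps)

lemma module_mult: "module ((*) :: 'r::comm_ring_1 \<Rightarrow> 'r \<Rightarrow> 'r)"
  by unfold_locales (auto simp: algebra_simps)

lemma linear_map_iff:
  "linear_map f \<longleftrightarrow> (\<forall>x y. f (x + y) = f x + f y) \<and> (\<forall>c x. f (c *s x) = c *s f x)"
  by (simp add: module_hom_iff module_vec)

lemma linear_functional_iff: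
  "linear_functional f \<longleftrightarrow> (\<forall>x y. f (x + y) = f x + f y) \<and> (\<forall>c x. f (c *s x) = c * f x)"
  by (simp add: module_hom_iff module_vec module_mult)

lemma linear_map_vec: "linear_map f \<Longrightarrow> Vector_Spaces.linear (*s) (*s) f"
  for f :: "'k::field ^ 'i::finite \<Rightarrow> 'k ^ 'j::finite"
  by (simp add: linear_map_iff Vector_Spaces.linear_iff vec.vector_space_axioms)

lemma vec_expand: "(x :: 'r::comm_ring_1 ^ 'i::finite) = (\<Sum>i\<in>UNIV. x $ i *s axis i 1)"
  by (simp add: vec_eq_iff axis_def if_distrib cong: if_cong)

lemma linear_map_expand:
  assumes "linear_map f"
  shows "f x = (\<Sum>i\<in>UNIV. x $ i *s f (axis i 1))"
proof -
  have "f x = f (\<Sum>i\<in>UNIV. x $ i *s axis i 1)"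
    by (rule arg_cong[OF vec_expand])
  also have "\<dots> = (\<Sum>i\<in>UNIV. x $ i *s f (axis i 1))"
    by (simp add: module_hom.sum[OF assms] module_hom.scale[OF assms])
  finally show ?thesis .
qed

lemma linear_functional_expand:
  assumes "linear_functional f"
  shows "f x = (\<Sum>i\<in>UNIV. x $ i * f (axis i 1))"
proof -
  have "f x = f (\<Sum>i\<in>UNIV. x $ i *s axis i 1)"
    by (rule arg_cong[OF vec_expand])
  also have "\<dots> = (\<Sum>i\<in>UNIV. x $ i * f (axis i 1))"
    by (simp add: module_hom.sum[OF assms] module_hom.scale[OF assms])
  finally show ?thesis .
qed

lemma linear_map_eqI:
  assumes "linear_map f" "linear_map g" "\<And>i. f (axis i 1) = g (axis i 1)"
  shows "f = g"
proof
  fix x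
  show "f x = g x"
    unfolding linear_map_expand[OF assms(1), of x] linear_map_expand[OF assms(2), of x]
    by (simp add: assms(3))
qed

lemma linear_map_compose: "linear_map f \<Longrightarrow> linear_map g \<Longrightarrow> linear_map (\<lambda>x. f (g x))"
  by (simp add: linear_map_iff)

lemma linear_map_id: "linear_map (\<lambda>x. x)" "linear_map id"
  by (simp_all add: linear_map_iff)

lemma linear_map_scale: "linear_map f \<Longrightarrow> linear_map (\<lambda>x. c *s f x)"
  by (auto simp: linear_map_iff vec_eq_iff algebra_simps)

lemma linear_map_sum: "(\<And>a. a \<in> A \<Longrightarrow> linear_map (f a)) \<Longrightarrow> linear_map (\<lambda>x. \<Sum>a\<in>A. f a x)"
  by (induction A rule: infinite_finite_induct)
    (auto simp: linear_map_iff vec_eq_iff algebra_simps)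

lemma linear_map_inv:
  assumes "linear_map f" "bij f"
  shows "linear_map (inv f)"
proof -
  have inv: "f (inv f x) = x" for x
    using assms(2) by (simp add: bij_is_surj surj_f_inv_f)
  have "inv f (x + y) = inv f x + inv f y" "inv f (c *s x) = c *s inv f x" for x y c
    by (rule injD[OF bij_is_inj[OF assms(2)]],
        simp add: inv module_hom.add[OF assms(1)] module_hom.scale[OF assms(1)])+
  then show ?thesis
    by (simp add: linear_map_iff)
qed

lemma linear_map_mult_vec: "linear_map ((*v) A)"
  by (simp add: linear_map_iff vec_eq_iff matrix_vector_mult_def sum.distrib sum_distrib_left
      algebra_simps)

lemma tens_component [simp]: "(v \<otimes>\<^sub>v w) $ (i, j) = v $ i * w $ j"
  by (simp add: tens_def)

lemma tens_axis: "axis i 1 \<otimes>\<^sub>v axis j 1 = axis (i, j) (1 :: 'r::comm_ring_1)"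
  by (auto simp: vec_eq_iff axis_def)

lemma tens_sum_left: "(\<Sum>a\<in>A. f a) \<otimes>\<^sub>v w = (\<Sum>a\<in>A. f a \<otimes>\<^sub>v w)"
  by (simp add: vec_eq_iff sum_distrib_right)

lemma tens_sum_right: "v \<otimes>\<^sub>v (\<Sum>a\<in>A. f a) = (\<Sum>a\<in>A. v \<otimes>\<^sub>v f a)"
  by (simp add: vec_eq_iff sum_distrib_left)

lemma tensor_linear_eqI:
  assumes "linear_map f" "linear_map g" "\<And>v w. f (v \<otimes>\<^sub>v w) = g (v \<otimes>\<^sub>v w)"
  shows "f = g"
  using assms by (intro linear_map_eqI) (auto simp flip: tens_axis)

lemma linear_tensor_map: "linear_map (tensor_map f g)"
  unfolding tensor_map_def linear_map_iff
  by (simp add: case_prod_unfold vec_eq_iff algebra_simps sum.distrib sum_distrib_left)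

lemma tensor_map_tens:
  assumes "linear_map f" "linear_map g"
  shows "tensor_map f g (v \<otimes>\<^sub>v w) = f v \<otimes>\<^sub>v g w"
proof -
  have "f v \<otimes>\<^sub>v g w = (\<Sum>i\<in>UNIV. v $ i *s f (axis i 1)) \<otimes>\<^sub>v (\<Sum>j\<in>UNIV. w $ j *s g (axis j 1))"
    by (rule arg_cong2[OF linear_map_expand linear_map_expand]) (use assms in auto)
  also have "\<dots> = (\<Sum>i\<in>UNIV. \<Sum>j\<in>UNIV. (v $ i * w $ j) *s (f (axis i 1) \<otimes>\<^sub>v g (axis j 1)))"
    unfolding tens_sum_left unfolding tens_sum_right by (simp add: vec_eq_iff algebra_simps)
  finally show ?thesis
    by (simp add: tensor_map_def sum.cartesian_product flip: UNIV_Times_UNIV)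
qed

lemma tensor_map_compose:
  assumes "linear_map f" "linear_map g" "linear_map f'" "linear_map g'"
  shows "tensor_map f g (tensor_map f' g' x) = tensor_map (\<lambda>y. f (f' y)) (\<lambda>y. g (g' y)) x"
proof -
  have "(\<lambda>x. tensor_map f g (tensor_map f' g' x)) = tensor_map (\<lambda>y. f (f' y)) (\<lambda>y. g (g' y))"
    by (rule tensor_linear_eqI)
      (simp_all add: tensor_map_tens assms linear_map_compose linear_tensor_map)
  then show ?thesis by metis
qed

lemma tensor_map_id: "tensor_map (\<lambda>x. x) (\<lambda>x. x) = (\<lambda>x. x)"
  by (rule tensor_linear_eqI) (simp_all add: tensor_map_tens linear_map_id linear_tensor_map)

section \<open>Isomorphisms of bialgebras\<close>

lemma bialgebra_iso_compose:
  assumes "bialgebra_iso f A B" "bialgebra_iso g B C"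
  shows "bialgebra_iso (\<lambda>x. g (f x)) A C"
  using assms bij_comp[of f g]
  by (auto simp: bialgebra_iso_def linear_map_compose tensor_map_compose comp_def)

lemma bialgebra_iso_inv:
  assumes "bialgebra_iso f A B"
  shows "bialgebra_iso (inv f) B A"
proof -
  have f: "linear_map f" "bij f" and
    hom: "\<And>a b. f (bmult A (a \<otimes>\<^sub>v b)) = bmult B (f a \<otimes>\<^sub>v f b)" "f (bone A) = bone B"
    "\<And>a. bcomult B (f a) = tensor_map f f (bcomult A a)" "\<And>a. bcounit B (f a) = bcounit A a"
    using assms by (auto simp: bialgebra_iso_def)
  have inv [simp]: "inv f (f x) = x" "f (inv f x) = x" for x
    using f(2) by (simp_all add: bij_is_inj bij_is_surj surj_f_inv_f)
  have lin: "linear_map (inv f)"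
    using f by (rule linear_map_inv)
  have mult: "inv f (bmult B (a \<otimes>\<^sub>v b)) = bmult A (inv f a \<otimes>\<^sub>v inv f b)" for a b
    by (metis hom(1) inv)
  have comult: "bcomult A (inv f a) = tensor_map (inv f) (inv f) (bcomult B a)" for a
  proof -
    have "tensor_map (inv f) (inv f) (bcomult B a) =
        tensor_map (inv f) (inv f) (tensor_map f f (bcomult A (inv f a)))"
      by (simp flip: hom(3))
    then show ?thesis
      by (simp add: tensor_map_compose f lin tensor_map_id)
  qed
  show ?thesis
    unfolding bialgebra_iso_def
    by (metis lin mult comult f(2) bij_imp_bij_inv hom(2,4) inv)
qed

section \<open>Specialisation of the deformation parameter\<close>

definition spec_vec :: "'k::comm_ring_1 \<Rightarrow> 'k poly ^ 'i::finite \<Rightarrow> 'k ^ 'i"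
  where "spec_vec l x = (\<chi> i. poly (x $ i) l)"

text \<open>For a \<open>'k[t]\<close>-linear \<open>f\<close>, the map that \<open>f\<close> induces modulo \<open>t - l\<close>. Constant vectors serve as
  representatives of the residue classes.\<close>

definition spec_map ::
    "'k::comm_ring_1 \<Rightarrow> ('k poly ^ 'i::finite \<Rightarrow> 'k poly ^ 'j::finite) \<Rightarrow> 'k ^ 'i \<Rightarrow> 'k ^ 'j"
  where "spec_map l f v = spec_vec l (f (const_vec v))"

definition specialize :: "'k::comm_ring_1 \<Rightarrow> ('k poly, 'n::finite) bialg \<Rightarrow> ('k, 'n) bialg"
  where "specialize l C =
    \<lparr> bmult = spec_map l (bmult C), bone = spec_vec l (bone C),
      bcomult = spec_map l (bcomult C), bcounit = (\<lambda>v. poly (bcounit C (const_vec v)) l) \<rparr>"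

lemma const_vec_component [simp]: "const_vec v $ i = [:v $ i:]"
  by (simp add: const_vec_def)

lemma spec_vec_component [simp]: "spec_vec l x $ i = poly (x $ i) l"
  by (simp add: spec_vec_def)

lemma const_vec_axis [simp]: "const_vec (axis i 1) = axis i 1"
  by (simp add: vec_eq_iff axis_def flip: one_pCons)

lemma const_vec_add: "const_vec (v + w) = const_vec v + const_vec w"
  by (simp add: vec_eq_iff)

lemma const_vec_scale: "const_vec (c *s v) = [:c:] *s const_vec v"
  by (simp add: vec_eq_iff)

lemma const_vec_zero [simp]: "const_vec 0 = 0"
  by (simp add: vec_eq_iff)

lemma spec_vec_const [simp]: "spec_vec l (const_vec v) = v"
  by (simp add: vec_eq_iff)

lemma spec_vec_add: "spec_vec l (x + y) = spec_vec l x + spec_vec l y"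
  by (simp add: vec_eq_iff)

lemma spec_vec_scale: "spec_vec l (p *s x) = poly p l *s spec_vec l x"
  by (simp add: vec_eq_iff)

lemma spec_vec_sum: "spec_vec l (\<Sum>a\<in>A. f a) = (\<Sum>a\<in>A. spec_vec l (f a))"
  by (simp add: vec_eq_iff poly_sum)

lemma spec_vec_tens: "spec_vec l (x \<otimes>\<^sub>v y) = spec_vec l x \<otimes>\<^sub>v spec_vec l y"
  by (simp add: vec_eq_iff)

lemma spec_vec_axis [simp]: "spec_vec l (axis i 1) = axis i 1"
  by (metis spec_vec_const const_vec_axis)

text \<open>A polynomial over an infinite field is determined by its values, and omitting one value does
  no harm. This reduces identities over \<open>'k[t]\<close> to identities over \<open>'k\<close> for each \<open>t = l \<noteq> 0\<close>.\<close>

lemma poly_eq_from_nonzero_values: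
  fixes p q :: "'k::field_char_0 poly"
  assumes "\<And>l. l \<noteq> 0 \<Longrightarrow> poly p l = poly q l"
  shows "p = q"
proof (rule ccontr)
  assume "p \<noteq> q"
  then have "finite {l. poly (p - q) l = 0}"
    by (intro poly_roots_finite) simp
  moreover have "UNIV \<subseteq> insert 0 {l. poly (p - q) l = 0}"
    using assms by auto
  ultimately show False
    by (metis finite_insert finite_subset infinite_UNIV_char_0)
qed

lemma spec_vec_eqI:
  fixes x y :: "'k::field_char_0 poly ^ 'i::finite"
  assumes "\<And>l. l \<noteq> 0 \<Longrightarrow> spec_vec l x = spec_vec l y"
  shows "x = y"
  using assms by (auto simp: vec_eq_iff intro: poly_eq_from_nonzero_values)

lemma spec_vec_linear:
  assumes "linear_map f"
  shows "spec_vec l (f x) = spec_map l f (spec_vec l x)"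
  unfolding spec_map_def linear_map_expand[OF assms, of x]
    linear_map_expand[OF assms, of "const_vec _"]
  by (simp add: spec_vec_sum spec_vec_scale)

lemma spec_functional_linear:
  assumes "linear_functional f"
  shows "poly (f x) l = poly (f (const_vec (spec_vec l x))) l"
  unfolding linear_functional_expand[OF assms, of x]
    linear_functional_expand[OF assms, of "const_vec _"]
  by (simp add: poly_sum)

lemma linear_spec_map: "linear_map f \<Longrightarrow> linear_map (spec_map l f)"
  unfolding linear_map_iff
  by (simp add: spec_map_def const_vec_add const_vec_scale spec_vec_add spec_vec_scale)

lemma spec_map_compose: "linear_map f \<Longrightarrow> spec_map l (\<lambda>x. f (g x)) v = spec_map l f (spec_map l g v)"
  by (simp add: spec_map_def[of l "\<lambda>x. f (g x)"] spec_map_def[of l g] spec_vec_linear)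

lemma spec_map_id: "spec_map l (\<lambda>x. x) v = v" "spec_map l id v = v"
  by (simp_all add: spec_map_def)

lemma spec_tensor_map:
  "spec_vec l (tensor_map f g x) = tensor_map (spec_map l f) (spec_map l g) (spec_vec l x)"
  by (simp add: tensor_map_def case_prod_unfold spec_vec_sum spec_vec_scale spec_vec_tens
      spec_map_def)

lemma spec_contract_left:
  "spec_vec l (contract_left f x) = contract_left (\<lambda>v. poly (f (const_vec v)) l) (spec_vec l x)"
  by (simp add: contract_left_def case_prod_unfold spec_vec_sum spec_vec_scale)

lemma spec_contract_right:
  "spec_vec l (contract_right f x) = contract_right (\<lambda>v. poly (f (const_vec v)) l) (spec_vec l x)"
  by (simp add: contract_right_def case_prod_unfold spec_vec_sum spec_vec_scale)

lemma spec_tensor_assoc: "spec_vec l (tensor_assoc x) = tensor_assoc (spec_vec l x)"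
  by (simp add: tensor_assoc_def vec_eq_iff case_prod_unfold)

lemma spec_middle_swap: "spec_vec l (middle_swap x) = middle_swap (spec_vec l x)"
  by (simp add: middle_swap_def vec_eq_iff case_prod_unfold)

lemmas spec_structure = spec_vec_tens spec_tensor_map spec_contract_left spec_contract_right
  spec_tensor_assoc spec_middle_swap

text \<open>Linearity over \<open>'k[t]\<close> is the part of the bialgebra axioms that the fibres cannot detect.\<close>

definition linear_structure :: "('r::comm_ring_1, 'n::finite) bialg \<Rightarrow> bool"
  where "linear_structure C \<longleftrightarrow>
    linear_map (bmult C) \<and> linear_map (bcomult C) \<and> linear_functional (bcounit C)"

lemma bialgebra_linear_structure: "bialgebra C \<Longrightarrow> linear_structure C"
  by (simp add: bialgebra_def linear_structure_def)

lemma linear_structure_eqI: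
  fixes A B :: "('k::field, 'n::finite) bialg"
  assumes "linear_structure A" "linear_structure B" "struct_consts A = struct_consts B"
  shows "A = B"
proof -
  have sc: "struct_consts A c = struct_consts B c" for c
    using assms(3) by simp
  have "bmult A = bmult B"
  proof (rule linear_map_eqI)
    fix p :: "'n \<times> 'n"
    show "bmult A (axis p 1) = bmult B (axis p 1)"
      using sc[of "MultC (fst p) (snd p) _"] by (simp add: vec_eq_iff tens_axis)
  qed (use assms in \<open>auto simp: linear_structure_def\<close>)
  moreover have "bcomult A = bcomult B"
  proof (rule linear_map_eqI)
    fix i :: 'n
    show "bcomult A (axis i 1) = bcomult B (axis i 1)"
      using sc[of "ComultC i _ _"] by (simp add: vec_eq_iff)
  qed (use assms in \<open>auto simp: linear_structure_def\<close>)
  moreover have "bcounit A v = bcounit B v" for v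
  proof -
    have "bcounit A v = (\<Sum>i\<in>UNIV. v $ i * bcounit A (axis i 1))"
      using assms(1) by (intro linear_functional_expand) (simp add: linear_structure_def)
    also have "\<dots> = (\<Sum>i\<in>UNIV. v $ i * bcounit B (axis i 1))"
      using sc[of "CounitC _"] by simp
    also have "\<dots> = bcounit B v"
      using assms(2) by (intro linear_functional_expand[symmetric]) (simp add: linear_structure_def)
    finally show ?thesis .
  qed
  moreover have "bone A = bone B"
    using sc[of "OneC _"] by (simp add: vec_eq_iff)
  ultimately show ?thesis
    by (intro bialg.equality) auto
qed

lemma linear_structure_specialize: "linear_structure C \<Longrightarrow> linear_structure (specialize l C)"
  unfolding linear_structure_def
  by (simp add: specialize_def linear_spec_map)
    (simp add: linear_functional_iff const_vec_add const_vec_scale)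

text \<open>Both sides of every bialgebra axiom commute with specialisation. Since specialisation is
  onto, the axioms pass from \<open>C\<close> to its fibres; since a vector is determined by its values at
  \<open>t = l \<noteq> 0\<close>, they pass back from these fibres to \<open>C\<close>.\<close>

lemma specialize_simps:
  assumes "linear_structure C"
  shows "bmult (specialize l C) (spec_vec l z) = spec_vec l (bmult C z)"
    "bone (specialize l C) = spec_vec l (bone C)"
    "bcomult (specialize l C) (spec_vec l x) = spec_vec l (bcomult C x)"
    "bcounit (specialize l C) (spec_vec l x) = poly (bcounit C x) l"
    "tensor_map (bmult (specialize l C)) (bmult (specialize l C)) (spec_vec l y) =
       spec_vec l (tensor_map (bmult C) (bmult C) y)"
    "tensor_map (bcomult (specialize l C)) id (spec_vec l z) =
       spec_vec l (tensor_map (bcomult C) id z)"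
    "tensor_map id (bcomult (specialize l C)) (spec_vec l z) =
       spec_vec l (tensor_map id (bcomult C) z)"
    "contract_left (bcounit (specialize l C)) (spec_vec l z) =
       spec_vec l (contract_left (bcounit C) z)"
    "contract_right (bcounit (specialize l C)) (spec_vec l z) =
       spec_vec l (contract_right (bcounit C) z)"
proof -
  have "spec_map l (id :: 'a poly ^ 'b \<Rightarrow> _) = id"
    by (simp add: fun_eq_iff spec_map_id)
  with assms show
    "bmult (specialize l C) (spec_vec l z) = spec_vec l (bmult C z)"
    "bone (specialize l C) = spec_vec l (bone C)"
    "bcomult (specialize l C) (spec_vec l x) = spec_vec l (bcomult C x)"
    "bcounit (specialize l C) (spec_vec l x) = poly (bcounit C x) l"
    "tensor_map (bmult (specialize l C)) (bmult (specialize l C)) (spec_vec l y) =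
       spec_vec l (tensor_map (bmult C) (bmult C) y)"
    "tensor_map (bcomult (specialize l C)) id (spec_vec l z) =
       spec_vec l (tensor_map (bcomult C) id z)"
    "tensor_map id (bcomult (specialize l C)) (spec_vec l z) =
       spec_vec l (tensor_map id (bcomult C) z)"
    "contract_left (bcounit (specialize l C)) (spec_vec l z) =
       spec_vec l (contract_left (bcounit C) z)"
    "contract_right (bcounit (specialize l C)) (spec_vec l z) =
       spec_vec l (contract_right (bcounit C) z)"
    by (simp_all add: specialize_def linear_structure_def spec_vec_linear spec_structure
        spec_functional_linear[of "bcounit C" x])
qed

lemma bialgebra_specialize:
  assumes "bialgebra C"
  shows "bialgebra (specialize l C)"
proof -
  have lin: "linear_structure C"
    using assms by (rule bialgebra_linear_structure)
  note S = specialize_simps[OF lin, of l]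
  have linS: "linear_structure (specialize l C)"
    using lin by (rule linear_structure_specialize)
  show ?thesis
    unfolding bialgebra_def
  proof (intro conjI allI)
    fix a b c :: "'a ^ 'b"
    obtain x y z where [simp]: "a = spec_vec l x" "b = spec_vec l y" "c = spec_vec l z"
      by (metis spec_vec_const)
    show "module_hom (*s) (*s) (bmult (specialize l C))"
      "module_hom (*s) (*s) (bcomult (specialize l C))"
      "module_hom (*s) (*) (bcounit (specialize l C))"
      using linS by (simp_all add: linear_structure_def)
    show "bmult (specialize l C) (bmult (specialize l C) (a \<otimes>\<^sub>v b) \<otimes>\<^sub>v c) =
        bmult (specialize l C) (a \<otimes>\<^sub>v bmult (specialize l C) (b \<otimes>\<^sub>v c))"
      "bmult (specialize l C) (bone (specialize l C) \<otimes>\<^sub>v a) = a"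
      "bmult (specialize l C) (a \<otimes>\<^sub>v bone (specialize l C)) = a"
      "tensor_assoc (tensor_map (bcomult (specialize l C)) id (bcomult (specialize l C) a)) =
        tensor_map id (bcomult (specialize l C)) (bcomult (specialize l C) a)"
      "contract_left (bcounit (specialize l C)) (bcomult (specialize l C) a) = a"
      "contract_right (bcounit (specialize l C)) (bcomult (specialize l C) a) = a"
      "bcomult (specialize l C) (bmult (specialize l C) (a \<otimes>\<^sub>v b)) =
         tensor_map (bmult (specialize l C)) (bmult (specialize l C))
           (middle_swap (bcomult (specialize l C) a \<otimes>\<^sub>v bcomult (specialize l C) b))"
      "bcomult (specialize l C) (bone (specialize l C)) =
        bone (specialize l C) \<otimes>\<^sub>v bone (specialize l C)"
      "bcounit (specialize l C) (bmult (specialize l C) (a \<otimes>\<^sub>v b)) =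
        bcounit (specialize l C) a * bcounit (specialize l C) b"
      "bcounit (specialize l C) (bone (specialize l C)) = 1"
      using assms
      by (simp_all add: S bialgebra_def flip: spec_vec_tens spec_tensor_assoc spec_middle_swap)
  qed
qed

lemma bialgebra_of_fibres:
  fixes C :: "('k::field_char_0 poly, 'n::finite) bialg"
  assumes lin: "linear_structure C" and fib: "\<And>l. l \<noteq> 0 \<Longrightarrow> bialgebra (specialize l C)"
  shows "bialgebra C"
proof -
  note S = specialize_simps[OF lin, symmetric]
  show ?thesis
    unfolding bialgebra_def
  proof (intro conjI allI)
    show "module_hom (*s) (*s) (bmult C)" "module_hom (*s) (*s) (bcomult C)"
      "module_hom (*s) (*) (bcounit C)"
      using lin by (simp_all add: linear_structure_def)
  next
    fix a b c
    show "bmult C (bmult C (a \<otimes>\<^sub>v b) \<otimes>\<^sub>v c) = bmult C (a \<otimes>\<^sub>v bmult C (b \<otimes>\<^sub>v c))"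
      by (rule spec_vec_eqI, drule fib)
        (simp add: S bialgebra_def spec_structure(1))
    show "bmult C (bone C \<otimes>\<^sub>v a) = a" "bmult C (a \<otimes>\<^sub>v bone C) = a"
      by (rule spec_vec_eqI, drule fib, simp add: S bialgebra_def spec_structure(1))+
    show "tensor_assoc (tensor_map (bcomult C) id (bcomult C a)) =
        tensor_map id (bcomult C) (bcomult C a)"
      "contract_left (bcounit C) (bcomult C a) = a" "contract_right (bcounit C) (bcomult C a) = a"
      by (rule spec_vec_eqI, drule fib, simp add: S bialgebra_def spec_tensor_assoc)+
    show "bcomult C (bmult C (a \<otimes>\<^sub>v b)) =
        tensor_map (bmult C) (bmult C) (middle_swap (bcomult C a \<otimes>\<^sub>v bcomult C b))"
      "bcomult C (bone C) = bone C \<otimes>\<^sub>v bone C"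
      by (rule spec_vec_eqI, drule fib,
          simp add: S bialgebra_def spec_middle_swap spec_structure(1))+
    show "bcounit C (bmult C (a \<otimes>\<^sub>v b)) = bcounit C a * bcounit C b" "bcounit C (bone C) = 1"
      by (rule poly_eq_from_nonzero_values, drule fib,
          simp add: S bialgebra_def spec_structure(1))+
  qed
qed

text \<open>Bijectivity survives because the inverse specialises as well.\<close>

lemma bialgebra_iso_specialize:
  assumes "linear_structure C" "linear_structure D" "bialgebra_iso \<phi> C D"
  shows "bialgebra_iso (spec_map l \<phi>) (specialize l C) (specialize l D)"
proof -
  note S = specialize_simps[OF assms(1), of l] specialize_simps[OF assms(2), of l]
  have \<phi>: "linear_map \<phi>" "bij \<phi>"
    using assms(3) by (auto simp: bialgebra_iso_def)
  have \<phi>': "linear_map (inv \<phi>)" and inv: "inv \<phi> (\<phi> x) = x" "\<phi> (inv \<phi> x) = x" for x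
    using \<phi> by (simp_all add: linear_map_inv bij_is_inj bij_is_surj surj_f_inv_f)
  have "spec_map l (inv \<phi>) (spec_map l \<phi> v) = v" "spec_map l \<phi> (spec_map l (inv \<phi>) v) = v" for v
    using spec_map_compose[OF \<phi>', of l \<phi> v] spec_map_compose[OF \<phi>(1), of l "inv \<phi>" v]
    by (simp_all add: inv spec_map_id)
  then have "bij (spec_map l \<phi>)"
    by (metis bijI')
  moreover have
    "spec_map l \<phi> (bmult (specialize l C) (a \<otimes>\<^sub>v b)) =
       bmult (specialize l D) (spec_map l \<phi> a \<otimes>\<^sub>v spec_map l \<phi> b)"
    "bcomult (specialize l D) (spec_map l \<phi> a) =
       tensor_map (spec_map l \<phi>) (spec_map l \<phi>) (bcomult (specialize l C) a)"
    "bcounit (specialize l D) (spec_map l \<phi> a) = bcounit (specialize l C) a" for a b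
  proof -
    obtain x y where [simp]: "a = spec_vec l x" "b = spec_vec l y"
      by (metis spec_vec_const)
    show "spec_map l \<phi> (bmult (specialize l C) (a \<otimes>\<^sub>v b)) =
       bmult (specialize l D) (spec_map l \<phi> a \<otimes>\<^sub>v spec_map l \<phi> b)"
      "bcomult (specialize l D) (spec_map l \<phi> a) =
       tensor_map (spec_map l \<phi>) (spec_map l \<phi>) (bcomult (specialize l C) a)"
      "bcounit (specialize l D) (spec_map l \<phi> a) = bcounit (specialize l C) a"
      using assms(3)
      by (simp_all add: S bialgebra_iso_def flip: spec_vec_linear[OF \<phi>(1)] spec_vec_tens spec_tensor_map)
  qed
  moreover have "spec_map l \<phi> (bone (specialize l C)) = bone (specialize l D)"
    using assms(3) by (simp add: S bialgebra_iso_def flip: spec_vec_linear[OF \<phi>(1)])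
  ultimately show ?thesis
    by (simp add: bialgebra_iso_def linear_spec_map \<phi>)
qed

lemma bialgebra_iso_of_fibres:
  fixes C D :: "('k::field_char_0 poly, 'n::finite) bialg"
  assumes lin: "linear_structure C" "linear_structure D" and \<phi>: "linear_map \<phi>" "bij \<phi>"
    and fib: "\<And>l. l \<noteq> 0 \<Longrightarrow> bialgebra_iso (spec_map l \<phi>) (specialize l C) (specialize l D)"
  shows "bialgebra_iso \<phi> C D"
proof -
  note S = specialize_simps[OF lin(1), symmetric] specialize_simps[OF lin(2), symmetric]
    spec_vec_linear[OF \<phi>(1)] spec_vec_tens spec_tensor_map
  show ?thesis
    unfolding bialgebra_iso_def
  proof (intro conjI allI)
    fix a b
    show "\<phi> (bmult C (a \<otimes>\<^sub>v b)) = bmult D (\<phi> a \<otimes>\<^sub>v \<phi> b)" "\<phi> (bone C) = bone D"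
      "bcomult D (\<phi> a) = tensor_map \<phi> \<phi> (bcomult C a)"
      by (rule spec_vec_eqI, drule fib, simp add: S bialgebra_iso_def)+
    show "bcounit D (\<phi> a) = bcounit C a"
      by (rule poly_eq_from_nonzero_values, drule fib, simp add: S bialgebra_iso_def)
  qed (use \<phi> in auto)
qed

section \<open>Extension of scalars and homogeneous maps over the polynomial ring\<close>

lemma const_vec_sum: "const_vec (\<Sum>a\<in>A. f a) = (\<Sum>a\<in>A. const_vec (f a))"
  by (induction A rule: infinite_finite_induct) (simp_all add: const_vec_add)

lemma linear_ext_map: "linear_map (ext_map f)"
  unfolding ext_map_def linear_map_iff
  by (simp add: vec_eq_iff algebra_simps sum.distrib sum_distrib_left)

lemma ext_map_const:
  assumes "linear_map f"
  shows "ext_map f (const_vec v) = const_vec (f v)"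
  unfolding linear_map_expand[OF assms, of v] ext_map_def const_vec_sum const_vec_scale by simp

lemma spec_ext_map: "linear_map f \<Longrightarrow> spec_map l (ext_map f) = f"
  by (simp add: fun_eq_iff spec_map_def ext_map_const)

lemma linear_ext_functional: "linear_functional (ext_functional f)"
  unfolding ext_functional_def linear_functional_iff
  by (simp add: algebra_simps sum.distrib sum_distrib_left)

lemma spec_ext_functional:
  assumes "linear_functional f"
  shows "poly (ext_functional f (const_vec v)) l = f v"
  unfolding linear_functional_expand[OF assms, of v] ext_functional_def by (simp add: poly_sum mult.commute)

lemma eq_mod_t_iff: "eq_mod_t f g \<longleftrightarrow> (\<forall>x. spec_vec 0 (f x) = spec_vec 0 (g x))"
  for f g :: "'a \<Rightarrow> 'k::field poly ^ 'j::finite"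
proof
  assume L: "eq_mod_t f g"
  show "\<forall>x. spec_vec 0 (f x) = spec_vec 0 (g x)"
  proof
    fix x
    obtain y where "f x - g x = monom 1 1 *s y"
      using L unfolding eq_mod_t_def by blast
    then have "f x = g x + monom 1 1 *s y"
      by (simp add: algebra_simps)
    then show "spec_vec 0 (f x) = spec_vec 0 (g x)"
      by (simp add: spec_vec_add spec_vec_scale poly_monom)
  qed
next
  assume R: "\<forall>x. spec_vec 0 (f x) = spec_vec 0 (g x)"
  show "eq_mod_t f g"
    unfolding eq_mod_t_def
  proof
    fix x
    have "\<exists>q. f x $ i - g x $ i = monom 1 1 * q" for i
    proof -
      have "poly (f x $ i - g x $ i) 0 = 0"
        using R by (simp add: vec_eq_iff)
      then have "[:-0, 1:] dvd f x $ i - g x $ i"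
        by (simp only: poly_eq_0_iff_dvd)
      then show ?thesis
        by (simp add: dvd_def monom_altdef)
    qed
    then obtain q where "\<And>i. f x $ i - g x $ i = monom 1 1 * q i"
      by metis
    then have "f x - g x = monom 1 1 *s (\<chi> i. q i)"
      by (simp add: vec_eq_iff)
    then show "\<exists>y. f x - g x = monom 1 1 *s y" ..
  qed
qed

lemma poly_grading_monom:
  assumes "\<And>i. 0 \<in> V i" "b \<in> V i"
  shows "monom 1 j *s const_vec b \<in> poly_grading V (i + j)"
proof -
  let ?b = "\<lambda>k. if k = j then b else 0"
  have "monom 1 j *s const_vec b = (\<Sum>k\<le>i + j. if k = j then monom 1 j *s const_vec b else 0)"
    by simp
  also have "\<dots> = (\<Sum>k\<le>i + j. monom 1 k *s const_vec (?b k))"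
    by (intro sum.cong) auto
  finally show ?thesis
    using assms unfolding poly_grading_def by (auto intro!: exI[of _ ?b])
qed

lemma poly_grading_sum:
  assumes V: "\<And>i. vec.subspace (V i)" and "\<And>a. a \<in> A \<Longrightarrow> f a \<in> poly_grading V d"
  shows "(\<Sum>a\<in>A. f a) \<in> poly_grading V d"
proof -
  from assms(2) have "\<exists>b. (\<forall>j\<le>d. b j \<in> V (d - j)) \<and> f a = (\<Sum>j\<le>d. monom 1 j *s const_vec (b j))"
    if "a \<in> A" for a
    using that unfolding poly_grading_def by blast
  then obtain b where b: "\<And>a j. a \<in> A \<Longrightarrow> j \<le> d \<Longrightarrow> b a j \<in> V (d - j)"
    "\<And>a. a \<in> A \<Longrightarrow> f a = (\<Sum>j\<le>d. monom 1 j *s const_vec (b a j))"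
    by metis
  have "(\<Sum>a\<in>A. f a) = (\<Sum>a\<in>A. \<Sum>j\<le>d. monom 1 j *s const_vec (b a j))"
    using b(2) by simp
  also have "\<dots> = (\<Sum>j\<le>d. monom 1 j *s const_vec (\<Sum>a\<in>A. b a j))"
    unfolding const_vec_sum by (subst sum.swap) (simp add: vec_eq_iff sum_distrib_left)
  finally show ?thesis
    using b(1) V unfolding poly_grading_def
    by (auto intro!: exI[of _ "\<lambda>j. \<Sum>a\<in>A. b a j"] vec.subspace_sum)
qed

lemma poly_grading_shift:
  assumes V: "\<And>i. vec.subspace (V i)" and x: "x \<in> poly_grading V d"
  shows "monom 1 k *s x \<in> poly_grading V (d + k)"
proof -
  obtain b where b: "\<forall>j\<le>d. b j \<in> V (d - j)" "x = (\<Sum>j\<le>d. monom 1 j *s const_vec (b j))"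
    using x unfolding poly_grading_def by blast
  have "monom 1 k *s x = (\<Sum>j\<le>d. monom 1 (j + k) *s const_vec (b j))"
    by (simp add: b(2) vec_eq_iff sum_distrib_left mult_monom add.commute flip: mult.assoc)
  also have "\<dots> \<in> poly_grading V (d + k)"
  proof (rule poly_grading_sum[OF V])
    fix j assume "j \<in> {..d}"
    then show "monom 1 (j + k) *s const_vec (b j) \<in> poly_grading V (d + k)"
      using poly_grading_monom[of V "b j" "d - j" "j + k"] V b(1)
      by (auto simp: vec.subspace_0)
  qed
  finally show ?thesis .
qed

lemma homogeneous0_of_constants:
  assumes W: "\<And>i. vec.subspace (W i)" and \<Phi>: "linear_map \<Phi>"
    and const: "\<And>d b. b \<in> V d \<Longrightarrow> \<Phi> (const_vec b) \<in> poly_grading W d"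
  shows "homogeneous0 (poly_grading V) (poly_grading W) \<Phi>"
  unfolding homogeneous0_def
proof (intro allI image_subsetI)
  fix d x assume "x \<in> poly_grading V d"
  then obtain b where b: "\<forall>j\<le>d. b j \<in> V (d - j)" "x = (\<Sum>j\<le>d. monom 1 j *s const_vec (b j))"
    unfolding poly_grading_def by blast
  have "\<Phi> x = (\<Sum>j\<le>d. monom 1 j *s \<Phi> (const_vec (b j)))"
    by (simp add: b(2) module_hom.sum[OF \<Phi>] module_hom.scale[OF \<Phi>])
  also have "\<dots> \<in> poly_grading W d"
  proof (rule poly_grading_sum[OF W])
    fix j assume "j \<in> {..d}"
    then show "monom 1 j *s \<Phi> (const_vec (b j)) \<in> poly_grading W d"
      using poly_grading_shift[of W "\<Phi> (const_vec (b j))" "d - j" j, OF W const] b(1) by simp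
  qed
  finally show "\<Phi> x \<in> poly_grading W d" .
qed

lemma spec_map_homogeneous:
  assumes hom: "homogeneous0 (poly_grading V) (poly_grading W) \<Phi>"
    and V: "\<And>i. vec.subspace (V i)" and v: "v \<in> V d"
  obtains b where "\<And>j. j \<le> d \<Longrightarrow> b j \<in> W (d - j)"
    and "\<And>l. spec_map l \<Phi> v = (\<Sum>j\<le>d. l ^ j *s b j)"
proof -
  have "const_vec v \<in> poly_grading V d"
    using poly_grading_monom[of V v d 0] V v by (simp add: vec.subspace_0 monom_eq_1)
  then have "\<Phi> (const_vec v) \<in> poly_grading W d"
    using hom unfolding homogeneous0_def by blast
  then obtain b where "\<forall>j\<le>d. b j \<in> W (d - j)"
    "\<Phi> (const_vec v) = (\<Sum>j\<le>d. monom 1 j *s const_vec (b j))"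
    unfolding poly_grading_def by blast
  then show thesis
    by (intro that[of b]) (auto simp: spec_map_def spec_vec_sum spec_vec_scale poly_monom)
qed

text \<open>Specialising a homogeneous element of degree \<open>d\<close> multiplies its coefficient in \<open>W (d - j)\<close> by
  \<open>l ^ j\<close>, and \<open>T\<close> supplies the missing \<open>l ^ (d - j)\<close>.\<close>

lemma spec_map_homogeneous_scaling:
  assumes hom: "homogeneous0 (poly_grading V) (poly_grading W) \<Phi>"
    and V: "\<And>i. vec.subspace (V i)" and v: "v \<in> V d"
    and \<Phi>: "linear_map \<Phi>" and T: "linear_map T"
    and S_eq: "\<And>d v. v \<in> V d \<Longrightarrow> S v = l ^ d *s v" and T_eq: "\<And>d v. v \<in> W d \<Longrightarrow> T v = l ^ d *s v"
  shows "T (spec_map l \<Phi> v) = spec_map 1 \<Phi> (S v)"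
proof -
  obtain b where b: "\<And>j. j \<le> d \<Longrightarrow> b j \<in> W (d - j)"
    "\<And>l. spec_map l \<Phi> v = (\<Sum>j\<le>d. l ^ j *s b j)"
    using spec_map_homogeneous[OF hom V v] by metis
  have "T (spec_map l \<Phi> v) = (\<Sum>j\<le>d. l ^ j *s (l ^ (d - j) *s b j))"
    using T_eq[OF b(1)] by (simp add: b(2) module_hom.sum[OF T] module_hom.scale[OF T])
  also have "\<dots> = (\<Sum>j\<le>d. l ^ d *s b j)"
    by (simp flip: power_add)
  also have "\<dots> = l ^ d *s spec_map 1 \<Phi> v"
    by (simp add: b(2) vec.scale_sum_right)
  also have "\<dots> = spec_map 1 \<Phi> (S v)"
    using v by (simp add: S_eq module_hom.scale[OF linear_spec_map[OF \<Phi>]])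
  finally show ?thesis .
qed

section \<open>Gradings, the associated filtration, and homogenisation\<close>

locale graded_space =
  fixes G :: "nat \<Rightarrow> ('k::field_char_0 ^ 'n::finite) set"
  assumes grading: "is_grading G"
begin

definition component :: "nat \<Rightarrow> 'k ^ 'n \<Rightarrow> 'k ^ 'n"
  where "component d v =
    (THE c. (\<forall>i. c i \<in> G i) \<and> finite {i. c i \<noteq> 0} \<and> v = (\<Sum>i | c i \<noteq> 0. c i)) d"

lemma subspace: "vec.subspace (G d)"
  using grading by (simp add: is_grading_def)

lemma decomposition:
  "(\<forall>i. component i v \<in> G i) \<and> finite {i. component i v \<noteq> 0} \<and>
    v = (\<Sum>i | component i v \<noteq> 0. component i v)"
proof -
  have "\<exists>!c. (\<forall>i. c i \<in> G i) \<and> finite {i. c i \<noteq> 0} \<and> v = (\<Sum>i | c i \<noteq> 0. c i)"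
    using grading by (simp add: is_grading_def)
  from theI'[OF this] show ?thesis
    by (simp add: component_def[abs_def])
qed

lemma component_mem: "component d v \<in> G d"
  using decomposition by blast

lemma component_unique:
  assumes "\<And>i. c i \<in> G i" "finite S" "\<And>i. i \<notin> S \<Longrightarrow> c i = 0" "v = (\<Sum>i\<in>S. c i)"
  shows "component d v = c d"
proof -
  have ex1: "\<exists>!c. (\<forall>i. c i \<in> G i) \<and> finite {i. c i \<noteq> 0} \<and> v = (\<Sum>i | c i \<noteq> 0. c i)"
    using grading by (simp add: is_grading_def)
  have sub: "{i. c i \<noteq> 0} \<subseteq> S"
    using assms(3) by blast
  have "(\<Sum>i | c i \<noteq> 0. c i) = v"
    unfolding assms(4) using sub assms(2) by (intro sum.mono_neutral_left) auto
  then have "(\<forall>i. c i \<in> G i) \<and> finite {i. c i \<noteq> 0} \<and> v = (\<Sum>i | c i \<noteq> 0. c i)"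
    using assms(1,2) sub finite_subset by auto
  then show ?thesis
    unfolding component_def by (subst the1_equality[OF ex1]) auto
qed

lemma component_homogeneous: "v \<in> G d \<Longrightarrow> component e v = (if e = d then v else 0)"
  by (rule component_unique[where S = "{d}"]) (auto simp: vec.subspace_0[OF subspace])

lemma linear_component: "linear_map (component d)"
proof -
  have "component d (v + w) = component d v + component d w" for v w
  proof (rule component_unique)
    let ?S = "{i. component i v \<noteq> 0} \<union> {i. component i w \<noteq> 0}"
    show "component i v + component i w \<in> G i" for i
      using vec.subspace_add[OF subspace] component_mem by blast
    show "finite ?S"
      using decomposition by blast
    show "i \<notin> ?S \<Longrightarrow> component i v + component i w = 0" for i
      by simp
    have "(\<Sum>i | component i v \<noteq> 0. component i v) = (\<Sum>i\<in>?S. component i v)"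
      "(\<Sum>i | component i w \<noteq> 0. component i w) = (\<Sum>i\<in>?S. component i w)"
      using \<open>finite ?S\<close> by (intro sum.mono_neutral_left; auto)+
    then show "v + w = (\<Sum>i\<in>?S. component i v + component i w)"
      using decomposition[of v] decomposition[of w] by (simp add: sum.distrib)
  qed
  moreover have "component d (c *s v) = c *s component d v" for c v
  proof (rule component_unique)
    show "c *s component i v \<in> G i" for i
      using vec.subspace_scale[OF subspace] component_mem by blast
    show "finite {i. component i v \<noteq> 0}"
      using decomposition by blast
    show "c *s v = (\<Sum>i | component i v \<noteq> 0. c *s component i v)"
      using decomposition[of v] by (metis vec.scale_sum_right)
  qed simp
  ultimately show ?thesis
    by (simp add: linear_map_iff)
qed

definition degrees :: "nat set"
  where "degrees = {d. G d \<noteq> {0}}"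

text \<open>Each standard basis vector has only finitely many nonzero components, and a degree in which
  all of them vanish contains nothing but \<open>0\<close>.\<close>

lemma finite_degrees: "finite degrees"
proof -
  have "degrees \<subseteq> (\<Union>i. {d. component d (axis i 1) \<noteq> 0})"
  proof
    fix d assume "d \<in> degrees"
    then obtain v where v: "v \<in> G d" "v \<noteq> 0"
      using vec.subspace_0[OF subspace[of d]] by (auto simp: degrees_def)
    have "(\<Sum>i\<in>UNIV. v $ i *s component d (axis i 1)) = v"
      using component_homogeneous[OF v(1), of d] by (simp flip: linear_map_expand[OF linear_component])
    then have "\<exists>i. component d (axis i 1) \<noteq> 0"
      using v(2) by (metis (no_types, lifting) sum.neutral vec.scale_zero_right)
    then show "d \<in> (\<Union>i. {d. component d (axis i 1) \<noteq> 0})"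
      by auto
  qed
  moreover have "finite (\<Union>i. {d. component d (axis i 1 :: 'k ^ 'n) \<noteq> 0})"
    using decomposition by auto
  ultimately show ?thesis
    by (rule finite_subset)
qed

lemma component_eq_0: "d \<notin> degrees \<Longrightarrow> component d v = 0"
  using component_mem[of d v] by (auto simp: degrees_def)

lemma sum_components: "(\<Sum>d\<in>degrees. component d v) = v"
proof -
  have "(\<Sum>d | component d v \<noteq> 0. component d v) = (\<Sum>d\<in>degrees. component d v)"
    using component_eq_0 by (intro sum.mono_neutral_left finite_degrees) auto
  then show ?thesis
    using decomposition[of v] by simp
qed

lemma eq_on_homogeneous:
  assumes "linear_map f" "linear_map g" "\<And>d v. v \<in> G d \<Longrightarrow> f v = g v"
  shows "f = g"
proof
  fix v
  have "f (\<Sum>d\<in>degrees. component d v) = g (\<Sum>d\<in>degrees. component d v)"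
    by (simp add: module_hom.sum[OF assms(1)] module_hom.sum[OF assms(2)] assms(3)[OF component_mem])
  then show "f v = g v"
    by (simp add: sum_components)
qed

lemma subspace_tensor_grading: "vec.subspace (tensor_grading G d)"
  by (simp add: tensor_grading_def)

lemma tens_mem_tensor_grading:
  assumes "v \<in> G d" "w \<in> G e"
  shows "v \<otimes>\<^sub>v w \<in> tensor_grading G (d + e)"
proof -
  have "v \<otimes>\<^sub>v w \<in> tensor_subspace (G d) (G (d + e - d))"
    using assms unfolding tensor_subspace_def by (intro vec.span_base) auto
  then show ?thesis
    unfolding tensor_grading_def by (intro vec.span_base) (auto intro!: bexI[of _ d])
qed

lemma eq_on_homogeneous_tensors:
  assumes "linear_map f" "linear_map g" "\<And>d x. x \<in> tensor_grading G d \<Longrightarrow> f x = g x"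
  shows "f = g"
proof (rule tensor_linear_eqI[OF assms(1,2)])
  fix v w :: "'k ^ 'n"
  have eq: "f (component d v \<otimes>\<^sub>v component e w) = g (component d v \<otimes>\<^sub>v component e w)" for d e
    by (rule assms(3)[OF tens_mem_tensor_grading[OF component_mem component_mem]])
  have "f ((\<Sum>d\<in>degrees. component d v) \<otimes>\<^sub>v (\<Sum>e\<in>degrees. component e w)) =
      g ((\<Sum>d\<in>degrees. component d v) \<otimes>\<^sub>v (\<Sum>e\<in>degrees. component e w))"
    unfolding tens_sum_left unfolding tens_sum_right
    by (simp add: module_hom.sum[OF assms(1)] module_hom.sum[OF assms(2)] eq)
  then show "f (v \<otimes>\<^sub>v w) = g (v \<otimes>\<^sub>v w)"
    by (simp add: sum_components)
qed

definition scaling :: "'k \<Rightarrow> 'k ^ 'n \<Rightarrow> 'k ^ 'n"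
  where "scaling l v = (\<Sum>d\<in>degrees. l ^ d *s component d v)"

lemma linear_scaling: "linear_map (scaling l)"
  unfolding scaling_def by (intro linear_map_sum linear_map_scale linear_component)

lemma scaling_homogeneous:
  assumes "v \<in> G d"
  shows "scaling l v = l ^ d *s v"
proof (cases "v = 0")
  case False
  then have "d \<in> degrees"
    using assms by (auto simp: degrees_def)
  have "scaling l v = (\<Sum>e\<in>degrees. if e = d then l ^ d *s v else 0)"
    unfolding scaling_def by (intro sum.cong) (auto simp: component_homogeneous[OF assms])
  then show ?thesis
    using \<open>d \<in> degrees\<close> by (simp add: finite_degrees)
qed (simp add: module_hom.zero[OF linear_scaling])

lemma scaling_scaling: "scaling a (scaling b v) = scaling (a * b) v"
proof -
  have "scaling a (scaling b v) = (\<Sum>d\<in>degrees. b ^ d *s scaling a (component d v))"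
    unfolding scaling_def[of b]
    by (simp add: module_hom.sum[OF linear_scaling] module_hom.scale[OF linear_scaling])
  also have "\<dots> = scaling (a * b) v"
    unfolding scaling_def[of "a * b"]
    by (simp add: scaling_homogeneous[OF component_mem] power_mult_distrib mult.commute)
  finally show ?thesis .
qed

lemma scaling_one: "scaling 1 v = v"
  by (simp add: scaling_def sum_components)

lemma scaling_inverse:
  assumes "l \<noteq> 0"
  shows "scaling (inverse l) (scaling l v) = v" "scaling l (scaling (inverse l) v) = v"
  using assms by (simp_all add: scaling_scaling scaling_one)

lemma bij_scaling: "l \<noteq> 0 \<Longrightarrow> bij (scaling l)"
  by (metis bijI' scaling_inverse)

lemma scaling_tensor:
  assumes "x \<in> tensor_grading G d"
  shows "tensor_map (scaling l) (scaling l) x = l ^ d *s x"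
proof -
  let ?E = "{x. tensor_map (scaling l) (scaling l) x = l ^ d *s x}"
  have E: "vec.subspace ?E"
    by (auto simp: vec.subspace_def module_hom.add[OF linear_tensor_map]
        module_hom.scale[OF linear_tensor_map] module_hom.zero[OF linear_tensor_map] algebra_simps
        vec.scale_right_distrib)
  have "tensor_subspace (G i) (G (d - i)) \<subseteq> ?E" if "i \<le> d" for i
    unfolding tensor_subspace_def
  proof (rule vec.span_minimal[OF _ E], safe)
    fix v w assume "v \<in> G i" "w \<in> G (d - i)"
    then have "tensor_map (scaling l) (scaling l) (v \<otimes>\<^sub>v w) = (l ^ i *s v) \<otimes>\<^sub>v (l ^ (d - i) *s w)"
      by (simp add: tensor_map_tens linear_scaling scaling_homogeneous)
    also have "\<dots> = (l ^ i * l ^ (d - i)) *s (v \<otimes>\<^sub>v w)"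
      by (simp add: vec_eq_iff algebra_simps)
    finally show "tensor_map (scaling l) (scaling l) (v \<otimes>\<^sub>v w) = l ^ d *s (v \<otimes>\<^sub>v w)"
      using that by (simp flip: power_add)
  qed
  then have "tensor_grading G d \<subseteq> ?E"
    unfolding tensor_grading_def by (intro vec.span_minimal[OF _ E]) auto
  then show ?thesis
    using assms by blast
qed

definition filtration :: "nat \<Rightarrow> ('k ^ 'n) set"
  where "filtration d = vec.span (\<Union>i\<le>d. G i)"

lemma filtration_iff: "v \<in> filtration d \<longleftrightarrow> (\<forall>e>d. component e v = 0)"
proof
  have "vec.subspace {v. \<forall>e>d. component e v = 0}"
    by (auto simp: vec.subspace_def module_hom.add[OF linear_component]
        module_hom.scale[OF linear_component] module_hom.zero[OF linear_component])
  moreover have "(\<Union>i\<le>d. G i) \<subseteq> {v. \<forall>e>d. component e v = 0}"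
    by (auto simp: component_homogeneous)
  ultimately have "filtration d \<subseteq> {v. \<forall>e>d. component e v = 0}"
    unfolding filtration_def by (intro vec.span_minimal)
  then show "v \<in> filtration d \<Longrightarrow> \<forall>e>d. component e v = 0"
    by blast
next
  assume R: "\<forall>e>d. component e v = 0"
  have "component e v \<in> filtration d" for e
  proof (cases "e \<le> d")
    case True
    then show ?thesis
      unfolding filtration_def by (intro vec.span_base) (auto intro: component_mem)
  qed (use R in \<open>auto simp: filtration_def vec.span_zero\<close>)
  then have "(\<Sum>e\<in>degrees. component e v) \<in> filtration d"
    unfolding filtration_def by (intro vec.span_sum)
  then show "v \<in> filtration d"
    by (simp add: sum_components)
qed

lemma homogeneous_in_filtration: "v \<in> G d \<Longrightarrow> v \<in> filtration d"
  unfolding filtration_def by (intro vec.span_base) auto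

definition filtered_map :: "('k ^ 'n \<Rightarrow> 'k ^ 'n) \<Rightarrow> bool"
  where "filtered_map f \<longleftrightarrow> linear_map f \<and> (\<forall>d. f ` filtration d \<subseteq> filtration d)"

lemma filtered_map_linear: "filtered_map f \<Longrightarrow> linear_map f"
  by (simp add: filtered_map_def)

lemma filtered_map_mem: "filtered_map f \<Longrightarrow> v \<in> filtration d \<Longrightarrow> f v \<in> filtration d"
  unfolding filtered_map_def by blast

lemma filtered_map_compose: "filtered_map f \<Longrightarrow> filtered_map g \<Longrightarrow> filtered_map (\<lambda>x. f (g x))"
  unfolding filtered_map_def by (simp add: linear_map_compose) blast

text \<open>An injective map of a finite-dimensional space into itself is onto, so \<open>f\<close> maps each step of
  the filtration onto itself.\<close>

lemma filtered_map_inv: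
  assumes "filtered_map f" "bij f"
  shows "filtered_map (inv f)"
proof -
  have f: "linear_map f" "Vector_Spaces.linear (*s) (*s) f"
    using assms(1) by (simp_all add: filtered_map_def linear_map_vec)
  have "f ` filtration d = filtration d" for d
  proof (rule vec.subspace_dim_equal)
    show "vec.subspace (f ` filtration d)"
      using f(2) by (intro vec.linear_subspace_image) (simp_all add: filtration_def)
    show "vec.subspace (filtration d)"
      by (simp add: filtration_def)
    show "f ` filtration d \<subseteq> filtration d"
      using assms(1) by (simp add: filtered_map_def)
    have "inj_on f (vec.span (filtration d))"
      using assms(2) bij_is_inj inj_on_subset by blast
    then have "vec.dim (f ` filtration d) = vec.dim (filtration d)"
      by (rule vec.dim_image_eq[OF f(2)])
    then show "vec.dim (filtration d) \<le> vec.dim (f ` filtration d)"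
      by simp
  qed
  then have "inv f ` filtration d \<subseteq> filtration d" for d
    using assms(2) by (metis bij_is_inj image_inv_f_f subset_refl)
  then show ?thesis
    using linear_map_inv[OF f(1) assms(2)] by (simp add: filtered_map_def)
qed

text \<open>The part of \<open>f\<close> that lowers the degree by \<open>j\<close> receives the factor \<open>t ^ j\<close>, which makes the
  total map homogeneous of degree \<open>0\<close>. For a filtered \<open>f\<close> no part raises the degree.\<close>

definition homogenize :: "('k ^ 'n \<Rightarrow> 'k ^ 'n) \<Rightarrow> 'k poly ^ 'n \<Rightarrow> 'k poly ^ 'n"
  where "homogenize f x =
    (\<Sum>d\<in>degrees. \<Sum>e\<le>d. monom 1 (d - e) *s ext_map (\<lambda>v. component e (f (component d v))) x)"

lemma linear_homogenize: "linear_map (homogenize f)"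
  unfolding homogenize_def by (intro linear_map_sum linear_map_scale linear_ext_map)

lemma linear_components: "linear_map f \<Longrightarrow> linear_map (\<lambda>v. component e (f (component d v)))"
  by (rule linear_map_compose[OF linear_component linear_map_compose[OF _ linear_component]])

lemma spec_homogenize:
  assumes "linear_map f"
  shows "spec_map l (homogenize f) v =
    (\<Sum>d\<in>degrees. \<Sum>e\<le>d. l ^ (d - e) *s component e (f (component d v)))"
  by (simp add: spec_map_def homogenize_def spec_vec_sum spec_vec_scale poly_monom
      ext_map_const[OF linear_components[OF assms]])

lemma sum_components_filtration:
  assumes "v \<in> filtration d"
  shows "(\<Sum>e\<le>d. component e v) = v"
proof -
  have "(\<Sum>e\<in>degrees. component e v) = (\<Sum>e\<in>degrees \<union> {..d}. component e v)"
    by (intro sum.mono_neutral_left) (auto simp: finite_degrees component_eq_0)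
  also have "\<dots> = (\<Sum>e\<le>d. component e v)"
    using assms by (intro sum.mono_neutral_right) (auto simp: finite_degrees filtration_iff)
  finally show ?thesis
    by (simp add: sum_components)
qed

text \<open>For \<open>l \<noteq> 0\<close> this presents the specialisation at \<open>t = l\<close> as a conjugate of \<open>f\<close>, from which
  the functoriality of homogenisation and its compatibility with bialgebra structures follow.\<close>

lemma scaling_spec_homogenize:
  assumes "filtered_map f"
  shows "scaling l (spec_map l (homogenize f) v) = f (scaling l v)"
proof -
  have f: "linear_map f" and fF: "f (component d v) \<in> filtration d" for d
    using assms homogeneous_in_filtration[OF component_mem]
    by (simp_all add: filtered_map_linear filtered_map_mem)
  have "scaling l (spec_map l (homogenize f) v) =
      (\<Sum>d\<in>degrees. \<Sum>e\<le>d. l ^ (d - e) *s (l ^ e *s component e (f (component d v))))"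
    by (simp add: spec_homogenize[OF f] module_hom.sum[OF linear_scaling]
        module_hom.scale[OF linear_scaling] scaling_homogeneous[OF component_mem])
  also have "\<dots> = (\<Sum>d\<in>degrees. \<Sum>e\<le>d. l ^ d *s component e (f (component d v)))"
    by (intro sum.cong) (auto simp flip: power_add)
  also have "\<dots> = (\<Sum>d\<in>degrees. l ^ d *s f (component d v))"
    by (simp add: sum_components_filtration[OF fF] flip: vec.scale_sum_right)
  also have "\<dots> = f (scaling l v)"
    by (simp add: scaling_def module_hom.sum[OF f] module_hom.scale[OF f])
  finally show ?thesis .
qed

lemma spec_homogenize_conj:
  assumes "filtered_map f" "l \<noteq> 0"
  shows "spec_map l (homogenize f) v = scaling (inverse l) (f (scaling l v))"
  using scaling_inverse(1)[OF assms(2)] by (simp flip: scaling_spec_homogenize[OF assms(1)])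

lemma homogenize_compose:
  assumes "filtered_map f" "filtered_map g"
  shows "homogenize (\<lambda>v. f (g v)) x = homogenize f (homogenize g x)"
proof (rule spec_vec_eqI)
  fix l :: 'k assume "l \<noteq> 0"
  then show "spec_vec l (homogenize (\<lambda>v. f (g v)) x) = spec_vec l (homogenize f (homogenize g x))"
    by (simp add: spec_vec_linear linear_homogenize spec_homogenize_conj filtered_map_compose
        assms scaling_inverse)
qed

lemma filtered_map_id: "filtered_map (\<lambda>v. v)"
  by (simp add: filtered_map_def linear_map_id)

lemma homogenize_id: "homogenize (\<lambda>v. v) x = x"
  by (rule spec_vec_eqI)
    (simp add: spec_vec_linear linear_homogenize spec_homogenize_conj filtered_map_id scaling_inverse)

lemma bij_homogenize:
  assumes "filtered_map f" "bij f"
  shows "bij (homogenize f)"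
proof -
  have "filtered_map (inv f)"
    using assms by (rule filtered_map_inv)
  moreover have "(\<lambda>v. f (inv f v)) = (\<lambda>v. v)" "(\<lambda>v. inv f (f v)) = (\<lambda>v. v)"
    using assms(2) by (simp_all add: bij_is_inj bij_is_surj surj_f_inv_f)
  ultimately have "homogenize f (homogenize (inv f) x) = x" "homogenize (inv f) (homogenize f x) = x"
    for x
    using assms(1) by (metis homogenize_compose homogenize_id)+
  then show ?thesis
    by (metis bijI')
qed

lemma homogenize_homogeneous:
  assumes "linear_map f"
  shows "homogeneous0 (poly_grading G) (poly_grading G) (homogenize f)"
proof (rule homogeneous0_of_constants[OF subspace linear_homogenize])
  fix d b assume b: "b \<in> G d"
  have "homogenize f (const_vec b) =
      (\<Sum>d'\<in>degrees. \<Sum>e\<le>d'. monom 1 (d' - e) *s const_vec (component e (f (component d' b))))"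
    by (simp add: homogenize_def ext_map_const[OF linear_components[OF assms]])
  also have "\<dots> \<in> poly_grading G d"
  proof (intro poly_grading_sum[OF subspace])
    fix d' e :: nat assume "e \<in> {..d'}"
    then show "monom 1 (d' - e) *s const_vec (component e (f (component d' b))) \<in> poly_grading G d"
      using poly_grading_monom[of G _ e "d' - e", OF _ component_mem]
        poly_grading_monom[of G 0 d 0]
      by (auto simp: component_homogeneous[OF b] module_hom.zero[OF assms]
          module_hom.zero[OF linear_component] vec.subspace_0[OF subspace])
  qed
  finally show "homogenize f (const_vec b) \<in> poly_grading G d" .
qed

text \<open>The map \<open>gr f\<close> between the graded pieces of the filtration, each identified with \<open>G d\<close>. At
  \<open>t = 0\<close> only the parts of \<open>f\<close> that preserve the degree survive.\<close>

definition associated_graded :: "('k ^ 'n \<Rightarrow> 'k ^ 'n) \<Rightarrow> 'k ^ 'n \<Rightarrow> 'k ^ 'n"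
  where "associated_graded f = spec_map 0 (homogenize f)"

lemma associated_graded_homogeneous:
  assumes "linear_map f" "v \<in> G d"
  shows "associated_graded f v = component d (f v)"
proof (cases "d \<in> degrees")
  case True
  have "associated_graded f v = (\<Sum>d'\<in>degrees. component d' (f (component d' v)))"
    unfolding associated_graded_def spec_homogenize[OF assms(1)]
  proof (rule sum.cong[OF refl])
    fix d'
    have "(\<Sum>e\<le>d'. 0 ^ (d' - e) *s component e (f (component d' v))) =
        (\<Sum>e\<le>d'. if e = d' then component d' (f (component d' v)) else 0)"
      by (intro sum.cong) auto
    then show "(\<Sum>e\<le>d'. 0 ^ (d' - e) *s component e (f (component d' v))) =
        component d' (f (component d' v))"
      by simp
  qed
  also have "\<dots> = (\<Sum>d'\<in>degrees. if d' = d then component d (f v) else 0)"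
    by (intro sum.cong) (auto simp: component_homogeneous[OF assms(2)] module_hom.zero[OF assms(1)]
        module_hom.zero[OF linear_component])
  also have "\<dots> = component d (f v)"
    using True by (simp add: finite_degrees)
  finally show ?thesis .
next
  case False
  then have "v = 0"
    using assms(2) by (simp add: degrees_def)
  then show ?thesis
    by (simp add: associated_graded_def module_hom.zero[OF linear_spec_map[OF linear_homogenize]]
        module_hom.zero[OF assms(1)] module_hom.zero[OF linear_component])
qed

lemma linear_associated_graded: "linear_map (associated_graded f)"
  unfolding associated_graded_def by (intro linear_spec_map linear_homogenize)

lemma associated_graded_compose:
  assumes "filtered_map f" "filtered_map g"
  shows "associated_graded (\<lambda>v. f (g v)) = (\<lambda>v. associated_graded f (associated_graded g v))"
  unfolding associated_graded_def homogenize_compose[OF assms, abs_def]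
  by (intro ext spec_map_compose linear_homogenize)

lemma associated_graded_id: "associated_graded (\<lambda>v. v) = (\<lambda>v. v)"
  by (simp add: associated_graded_def homogenize_id[abs_def] spec_map_id[abs_def])

lemma filtered_associated_graded:
  assumes "linear_map f"
  shows "filtered_map (associated_graded f)"
  unfolding filtered_map_def
proof (intro conjI allI)
  fix d
  have "associated_graded f ` (\<Union>i\<le>d. G i) \<subseteq> filtration d"
    unfolding filtration_def
    by (auto simp: associated_graded_homogeneous[OF assms] intro!: vec.span_base component_mem)
  then show "associated_graded f ` filtration d \<subseteq> filtration d"
    unfolding filtration_def
    by (subst vec.linear_span_image[OF linear_map_vec[OF linear_associated_graded], symmetric])
      (simp add: vec.span_minimal)
qed (rule linear_associated_graded)

lemma associated_graded_idem:
  assumes "linear_map f"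
  shows "associated_graded (associated_graded f) = associated_graded f"
  by (rule eq_on_homogeneous)
    (auto simp: linear_associated_graded associated_graded_homogeneous assms
      component_homogeneous[OF component_mem])

end

section \<open>Rigid bialgebras in polynomial families\<close>

lemma matrix_inv_mult:
  assumes "invertible A"
  shows "A ** matrix_inv A = mat 1" "matrix_inv A ** A = mat 1"
  using someI_ex[OF assms[unfolded invertible_def]] by (simp_all add: matrix_inv_def)

lemma base_change_iso:
  assumes "bialgebra B" "invertible A"
  shows "bialgebra_iso ((*v) (matrix_inv A)) (base_change A B) B"
proof -
  have inv: "matrix_inv A *v (A *v x) = x" "A *v (matrix_inv A *v x) = x" for x
    using assms(2) by (simp_all add: matrix_vector_mul_assoc matrix_inv_mult)
  then have "bij ((*v) (matrix_inv A))"
    by (metis bijI')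
  with inv show ?thesis
    by (simp add: bialgebra_iso_def base_change_def Let_def linear_map_mult_vec tensor_map_tens
        tensor_map_compose tensor_map_id)
qed

lemma linear_structure_base_change:
  assumes "bialgebra B"
  shows "linear_structure (base_change A B)"
proof -
  have B: "linear_map (bmult B)" "linear_map (bcomult B)" "linear_functional (bcounit B)"
    using bialgebra_linear_structure[OF assms] by (simp_all add: linear_structure_def)
  have "linear_functional (\<lambda>v. bcounit B (matrix_inv A *v v))"
    unfolding linear_functional_iff
    by (simp add: module_hom.add[OF linear_map_mult_vec] module_hom.scale[OF linear_map_mult_vec]
        module_hom.add[OF B(3)] module_hom.scale[OF B(3)])
  then show ?thesis
    unfolding linear_structure_def base_change_def Let_def
    by (simp add:
        linear_map_compose[OF linear_map_mult_vec linear_map_compose[OF B(1) linear_tensor_map]]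
        linear_map_compose[OF linear_tensor_map linear_map_compose[OF B(2) linear_map_mult_vec]])
qed

lemma base_change_one: "base_change (mat 1) B = B"
proof -
  have "matrix_inv (mat 1 :: 'a ^ 'b ^ 'b) = mat 1"
    by (metis matrix_inv_mult(1) matrix_mul_lid invertible_def)
  then have "(*v) (mat 1) = (\<lambda>x :: 'a ^ 'b. x)" "(*v) (matrix_inv (mat 1)) = (\<lambda>x :: 'a ^ 'b. x)"
    by (simp_all add: fun_eq_iff)
  then show ?thesis
    unfolding base_change_def Let_def by (simp add: tensor_map_id)
qed

lemma struct_consts_specialize_poly:
  "\<exists>q. \<forall>l. struct_consts (specialize l C) c = poly q l"
  for C :: "('k::field poly, 'n::finite) bialg"
proof (cases c)
  case (MultC i j k)
  then show ?thesis
    by (intro exI[of _ "bmult C (axis i 1 \<otimes>\<^sub>v axis j 1) $ k"])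
      (simp add: specialize_def spec_map_def tens_axis)
next
  case (OneC i)
  then show ?thesis
    by (intro exI[of _ "bone C $ i"]) (simp add: specialize_def)
next
  case (ComultC i j k)
  then show ?thesis
    by (intro exI[of _ "bcomult C (axis i 1) $ (j, k)"]) (simp add: specialize_def spec_map_def)
next
  case (CounitC i)
  then show ?thesis
    by (intro exI[of _ "bcounit C (axis i 1)"]) (simp add: specialize_def)
qed

lemma eval_mpoly_poly:
  "eval_mpoly (\<lambda>v. poly (q v) l) p =
    poly (\<Sum>m\<in>Poly_Mapping.keys p. [:Poly_Mapping.lookup p m:] *
      (\<Prod>v\<in>Poly_Mapping.keys m. q v ^ Poly_Mapping.lookup m v)) l"
  by (simp add: eval_mpoly_def poly_sum poly_prod)

text \<open>A polynomial in the structure constants that does not vanish at \<open>B\<close> restricts along the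
  family \<open>C\<close> to a polynomial in \<open>t\<close> that does not vanish at \<open>0\<close>, hence not at all but finitely many
  \<open>l\<close>. The conclusion asks for \<open>l \<noteq> 0\<close> because the fibre over \<open>0\<close> is \<open>B\<close> itself.\<close>

lemma rigid_generic_fibre:
  fixes B :: "('k::field_char_0, 'n::finite) bialg"
  assumes "rigid B" "bialgebra C" "specialize 0 C = B"
  obtains l f where "l \<noteq> 0" "bialgebra_iso f (specialize l C) B"
proof -
  have B: "bialgebra B"
    using bialgebra_specialize[OF assms(2), of 0] assms(3) by simp
  obtain Z where Z: "zariski_closed Z" "struct_consts ` GL_orbit B = Bialg - Z"
    using assms(1) unfolding rigid_def zariski_open_in_def by blast
  obtain P where P: "Z = {x. \<forall>p\<in>P. eval_mpoly x p = 0}"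
    using Z(1) unfolding zariski_closed_def by blast
  have "\<exists>q. \<forall>c l. struct_consts (specialize l C) c = poly (q c) l"
    using struct_consts_specialize_poly[of C] by metis
  then obtain q where "\<And>l. struct_consts (specialize l C) = (\<lambda>c. poly (q c) l)"
    by blast
  then have eval: "\<exists>r. \<forall>l. eval_mpoly (struct_consts (specialize l C)) p = poly r l" for p
    by (simp add: eval_mpoly_poly) blast
  have "invertible (mat 1 :: 'k ^ 'n ^ 'n)"
    by (metis invertible_def matrix_mul_lid)
  then have "B \<in> GL_orbit B"
    unfolding GL_orbit_def using base_change_one[of B] by (metis (mono_tags, lifting) mem_Collect_eq)
  then have "struct_consts B \<notin> Z"
    using Z(2) by blast
  then obtain p where p: "p \<in> P" "eval_mpoly (struct_consts (specialize 0 C)) p \<noteq> 0"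
    using P assms(3) by blast
  obtain r where r: "\<And>l. eval_mpoly (struct_consts (specialize l C)) p = poly r l"
    using eval by blast
  have "r \<noteq> 0"
    using p(2) r[of 0] by auto
  then obtain l where l: "l \<noteq> 0" "poly r l \<noteq> 0"
    using poly_eq_from_nonzero_values[of r 0] by auto
  then have "eval_mpoly (struct_consts (specialize l C)) p \<noteq> 0"
    by (simp add: r)
  then have "struct_consts (specialize l C) \<notin> Z"
    using P p(1) by blast
  moreover have "struct_consts (specialize l C) \<in> Bialg"
    using bialgebra_specialize[OF assms(2)] by (auto simp: Bialg_def)
  ultimately obtain A where A: "invertible A"
    "struct_consts (specialize l C) = struct_consts (base_change A B)"
    using Z(2) unfolding GL_orbit_def by blast
  have "specialize l C = base_change A B"
    using linear_structure_specialize[OF bialgebra_linear_structure[OF assms(2)]]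
      linear_structure_base_change[OF B] A(2)
    by (rule linear_structure_eqI)
  then show thesis
    using that l(1) base_change_iso[OF B A(1)] by metis
qed

section \<open>Isomorphisms and the coradical filtration\<close>

lemma tensor_map_image_tensor_subspace:
  fixes f :: "'k::field ^ 'a::finite \<Rightarrow> 'k ^ 'b::finite" and g :: "'k ^ 'c::finite \<Rightarrow> 'k ^ 'd::finite"
  assumes "linear_map f" "linear_map g" "x \<in> tensor_subspace V W"
  shows "tensor_map f g x \<in> tensor_subspace (f ` V) (g ` W)"
proof -
  have "tensor_map f g x \<in> vec.span (tensor_map f g ` {v \<otimes>\<^sub>v w |v w. v \<in> V \<and> w \<in> W})"
    using assms(3) unfolding tensor_subspace_def
    by (simp add: vec.linear_span_image[OF linear_map_vec[OF linear_tensor_map]])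
  also have "\<dots> \<subseteq> tensor_subspace (f ` V) (g ` W)"
    unfolding tensor_subspace_def
    by (intro vec.span_mono) (auto simp: tensor_map_tens assms(1,2), blast)
  finally show ?thesis .
qed

lemma tensor_subspace_mono: "V \<subseteq> V' \<Longrightarrow> W \<subseteq> W' \<Longrightarrow> tensor_subspace V W \<subseteq> tensor_subspace V' W'"
  unfolding tensor_subspace_def by (intro vec.span_mono) blast

lemma subcoalgebra_image:
  assumes f: "bialgebra_iso f A B" and D: "subcoalgebra A D"
  shows "subcoalgebra B (f ` D)"
proof -
  have lin: "linear_map f" and comult: "\<And>a. bcomult B (f a) = tensor_map f f (bcomult A a)"
    using f by (auto simp: bialgebra_iso_def)
  have "vec.subspace (f ` D)"
    using D by (simp add: subcoalgebra_def vec.linear_subspace_image[OF linear_map_vec[OF lin]])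
  moreover have "bcomult B (f v) \<in> tensor_subspace (f ` D) (f ` D)" if "v \<in> D" for v
    using that D unfolding comult subcoalgebra_def
    by (intro tensor_map_image_tensor_subspace lin) blast
  ultimately show ?thesis
    by (auto simp: subcoalgebra_def)
qed

lemma simple_subcoalgebra_image:
  assumes f: "bialgebra_iso f A B" and D: "simple_subcoalgebra A D"
  shows "simple_subcoalgebra B (f ` D)"
proof -
  have lin: "linear_map f" and bij: "bij f"
    using f by (auto simp: bialgebra_iso_def)
  have inv: "f ` inv f ` E = E" "inv f ` f ` E = E" for E
    using bij by (simp_all add: image_f_inv_f bij_is_surj image_inv_f_f bij_is_inj)
  have zero: "f ` {0} = {0}"
    by (simp add: module_hom.zero[OF lin])
  have "E = {0} \<or> E = f ` D" if E: "subcoalgebra B E" "E \<subseteq> f ` D" for E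
  proof -
    have "subcoalgebra A (inv f ` E)"
      using subcoalgebra_image[OF bialgebra_iso_inv[OF f] E(1)] .
    moreover have "inv f ` E \<subseteq> D"
      using image_mono[OF E(2), of "inv f"] by (simp only: inv)
    ultimately have "inv f ` E = {0} \<or> inv f ` E = D"
      using D by (simp add: simple_subcoalgebra_def)
    then show ?thesis
      by (metis inv(1) zero)
  qed
  moreover have "f ` D \<noteq> {0}"
    using D inv(2)[of D] inv(2)[of "{0}"] zero by (metis simple_subcoalgebra_def)
  ultimately show ?thesis
    using D subcoalgebra_image[OF f] by (auto simp: simple_subcoalgebra_def)
qed

lemma coradical_image:
  assumes f: "bialgebra_iso f A B"
  shows "f ` coradical A \<subseteq> coradical B"
proof -
  have lin: "linear_map f"
    using f by (auto simp: bialgebra_iso_def)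
  have "f ` \<Union> {D. simple_subcoalgebra A D} \<subseteq> \<Union> {D. simple_subcoalgebra B D}"
    using simple_subcoalgebra_image[OF f] by blast
  then show ?thesis
    unfolding coradical_def vec.linear_span_image[OF linear_map_vec[OF lin], symmetric]
    by (rule vec.span_mono)
qed

text \<open>The coradical filtration is defined from the coalgebra structure alone, so isomorphisms
  respect it.\<close>

lemma coradical_filtration_image:
  assumes f: "bialgebra_iso f A B"
  shows "f ` coradical_filtration A d \<subseteq> coradical_filtration B d"
proof (induction d)
  case 0
  show ?case
    using coradical_image[OF f] by simp
next
  case (Suc d)
  have lin: "linear_map f" and comult: "\<And>a. bcomult B (f a) = tensor_map f f (bcomult A a)"
    using f by (auto simp: bialgebra_iso_def)
  let ?S = "\<lambda>A. tensor_subspace UNIV (coradical_filtration A d) \<union> tensor_subspace (coradical A) UNIV"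
  have "tensor_map f f ` ?S A \<subseteq> ?S B"
    using tensor_map_image_tensor_subspace[OF lin lin, of _ UNIV "coradical_filtration A d"]
      tensor_map_image_tensor_subspace[OF lin lin, of _ "coradical A" UNIV]
      tensor_subspace_mono[OF subset_UNIV Suc.IH, of "range f"]
      tensor_subspace_mono[OF coradical_image[OF f] subset_UNIV, of "range f"]
    by blast
  then have "tensor_map f f ` vec.span (?S A) \<subseteq> vec.span (?S B)"
    unfolding vec.linear_span_image[OF linear_map_vec[OF linear_tensor_map], symmetric]
    by (rule vec.span_mono)
  then show ?case
    by (auto simp: comult)
qed

section \<open>Fibres of a graded deformation\<close>

locale graded_bialg = graded_space G
  for G :: "nat \<Rightarrow> ('k::field_char_0 ^ 'n::finite) set" +
  fixes B :: "('k, 'n) bialg"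
  assumes graded: "graded_bialgebra G B"
begin

abbreviation fibre ::
    "('k poly ^ ('n \<times> 'n) \<Rightarrow> 'k poly ^ 'n) \<Rightarrow> ('k poly ^ 'n \<Rightarrow> 'k poly ^ ('n \<times> 'n)) \<Rightarrow> 'k \<Rightarrow>
     ('k, 'n) bialg"
  where "fibre mt Dt l \<equiv> specialize l (deformed B mt Dt)"

lemma bialgebra: "bialgebra B"
  using graded by (simp add: graded_bialgebra_def)

lemma B_linear: "linear_map (bmult B)" "linear_map (bcomult B)" "linear_functional (bcounit B)"
  using bialgebra_linear_structure[OF bialgebra] by (simp_all add: linear_structure_def)

lemma fibre_simps:
  "bmult (fibre mt Dt l) = spec_map l mt" "bone (fibre mt Dt l) = bone B"
  "bcomult (fibre mt Dt l) = spec_map l Dt" "bcounit (fibre mt Dt l) = bcounit B"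
  by (simp_all add: specialize_def deformed_def spec_ext_functional B_linear)

lemma fibre_eq_B:
  assumes "spec_map l mt = bmult B" "spec_map l Dt = bcomult B"
  shows "fibre mt Dt l = B"
  by (intro bialg.equality) (simp_all add: fibre_simps assms)

lemma fibre_trivial: "fibre (ext_map (bmult B)) (ext_map (bcomult B)) l = B"
  by (intro fibre_eq_B spec_ext_map B_linear)

lemma deformation_trivial: "deformation G B (ext_map (bmult B)) (ext_map (bcomult B))"
proof -
  have "linear_structure (deformed B (ext_map (bmult B)) (ext_map (bcomult B)))"
    by (simp add: linear_structure_def deformed_def linear_ext_map linear_ext_functional)
  then have "bialgebra (deformed B (ext_map (bmult B)) (ext_map (bcomult B)))"
    by (rule bialgebra_of_fibres) (simp add: fibre_trivial bialgebra)
  moreover have "homogeneous0 (poly_grading (tensor_grading G)) (poly_grading G) (ext_map (bmult B))"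
  proof (rule homogeneous0_of_constants[OF subspace linear_ext_map])
    fix d b assume "b \<in> tensor_grading G d"
    then have "bmult B b \<in> G d"
      using graded unfolding graded_bialgebra_def by blast
    then show "ext_map (bmult B) (const_vec b) \<in> poly_grading G d"
      using poly_grading_monom[of G "bmult B b" d 0]
      by (simp add: ext_map_const B_linear vec.subspace_0[OF subspace] monom_eq_1)
  qed
  moreover have "homogeneous0 (poly_grading G) (poly_grading (tensor_grading G)) (ext_map (bcomult B))"
  proof (rule homogeneous0_of_constants[OF subspace_tensor_grading linear_ext_map])
    fix d b assume "b \<in> G d"
    then have "bcomult B b \<in> tensor_grading G d"
      using graded unfolding graded_bialgebra_def by blast
    then show "ext_map (bcomult B) (const_vec b) \<in> poly_grading (tensor_grading G) d"
      using poly_grading_monom[of "tensor_grading G" "bcomult B b" d 0]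
      by (simp add: ext_map_const B_linear vec.subspace_0[OF subspace_tensor_grading] monom_eq_1)
  qed
  ultimately show ?thesis
    by (simp add: deformation_def eq_mod_t_iff)
qed

lemma deformation_linear:
  assumes "deformation G B mt Dt"
  shows "linear_structure (deformed B mt Dt)" "linear_map mt" "linear_map Dt"
proof -
  show lin: "linear_structure (deformed B mt Dt)"
    using assms by (simp add: deformation_def bialgebra_linear_structure)
  then show "linear_map mt" "linear_map Dt"
    by (simp_all add: linear_structure_def deformed_def)
qed

text \<open>Being congruent to the trivial deformation modulo \<open>t\<close> is the same as having \<open>B\<close> as the
  fibre over \<open>t = 0\<close>.\<close>

lemma fibre_zero:
  assumes "deformation G B mt Dt"
  shows "fibre mt Dt 0 = B"
proof (rule fibre_eq_B)
  show "spec_map 0 mt = bmult B" "spec_map 0 Dt = bcomult B"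
    using assms by (simp_all add: deformation_def eq_mod_t_iff spec_map_def ext_map_const B_linear fun_eq_iff)
qed

text \<open>Homogeneity of degree \<open>0\<close> makes all fibres over \<open>l \<noteq> 0\<close> isomorphic: acting by \<open>l\<^sup>d\<close> in degree
  \<open>d\<close> trades the powers of \<open>t = l\<close> in the structure maps for powers of \<open>t = 1\<close>.\<close>

lemma fibre_scaling_iso:
  assumes d: "deformation G B mt Dt" and l: "l \<noteq> 0"
  shows "bialgebra_iso (scaling l) (fibre mt Dt l) (fibre mt Dt 1)"
proof -
  note lin = deformation_linear(2,3)[OF d]
  have mult: "(\<lambda>x. scaling l (spec_map l mt x)) =
      (\<lambda>x. spec_map 1 mt (tensor_map (scaling l) (scaling l) x))"
  proof (rule eq_on_homogeneous_tensors)
    fix e x assume "x \<in> tensor_grading G e"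
    then show "scaling l (spec_map l mt x) = spec_map 1 mt (tensor_map (scaling l) (scaling l) x)"
      using d
      by (intro spec_map_homogeneous_scaling[where V = "tensor_grading G" and W = G])
        (auto simp: deformation_def subspace_tensor_grading lin linear_scaling scaling_tensor
          scaling_homogeneous)
  qed (rule linear_map_compose[OF linear_scaling linear_spec_map[OF lin(1)]]
      linear_map_compose[OF linear_spec_map[OF lin(1)] linear_tensor_map])+
  have comult: "(\<lambda>v. tensor_map (scaling l) (scaling l) (spec_map l Dt v)) =
      (\<lambda>v. spec_map 1 Dt (scaling l v))"
  proof (rule eq_on_homogeneous)
    fix e v assume "v \<in> G e"
    then show "tensor_map (scaling l) (scaling l) (spec_map l Dt v) = spec_map 1 Dt (scaling l v)"
      using d
      by (intro spec_map_homogeneous_scaling[where V = G and W = "tensor_grading G"])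
        (auto simp: deformation_def subspace lin linear_tensor_map scaling_tensor
          scaling_homogeneous)
  qed (rule linear_map_compose[OF linear_tensor_map linear_spec_map[OF lin(2)]]
      linear_map_compose[OF linear_spec_map[OF lin(2)] linear_scaling])+
  have "scaling l (spec_map l mt (a \<otimes>\<^sub>v b)) = spec_map 1 mt (scaling l a \<otimes>\<^sub>v scaling l b)" for a b
    using fun_cong[OF mult, of "a \<otimes>\<^sub>v b"] by (simp add: tensor_map_tens linear_scaling)
  moreover have "scaling l (bone B) = bone B"
    using graded scaling_homogeneous[of "bone B" 0] by (simp add: graded_bialgebra_def)
  moreover have "bcounit B (scaling l v) = bcounit B v" for v
  proof -
    have "bcounit B (component e v) = 0" if "e \<noteq> 0" for e
      using graded component_mem[of e v] that unfolding graded_bialgebra_def by blast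
    then have eq: "l ^ e * bcounit B (component e v) = bcounit B (component e v)" for e
      by (cases "e = 0") auto
    have "bcounit B (scaling l v) = bcounit B (\<Sum>e\<in>degrees. component e v)"
      by (simp only: scaling_def module_hom.sum[OF B_linear(3)] module_hom.scale[OF B_linear(3)] eq)
    then show ?thesis
      by (simp add: sum_components)
  qed
  moreover have "spec_map 1 Dt (scaling l v) = tensor_map (scaling l) (scaling l) (spec_map l Dt v)" for v
    using fun_cong[OF comult, of v] by simp
  ultimately show ?thesis
    by (simp add: bialgebra_iso_def fibre_simps linear_scaling bij_scaling l)
qed

text \<open>Over \<open>t = l \<noteq> 0\<close> the homogenised map is \<open>f\<close> conjugated by the scaling isomorphisms between the
  fibres over \<open>l\<close> and over \<open>1\<close>, and these values of \<open>l\<close> suffice.\<close>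

lemma homogenize_iso:
  assumes d: "deformation G B mt Dt" and d': "deformation G B mt' Dt'"
    and f: "bialgebra_iso f (fibre mt Dt 1) (fibre mt' Dt' 1)" "filtered_map f"
  shows "bialgebra_iso (homogenize f) (deformed B mt Dt) (deformed B mt' Dt')"
proof (rule bialgebra_iso_of_fibres)
  show "bij (homogenize f)"
    using f by (simp add: bij_homogenize bialgebra_iso_def)
  fix l :: 'k assume l: "l \<noteq> 0"
  have "spec_map l (homogenize f) = (\<lambda>v. inv (scaling l) (f (scaling l v)))"
    using scaling_spec_homogenize[OF f(2), of l] bij_scaling[OF l] by (metis bij_inv_eq_iff)
  then show "bialgebra_iso (spec_map l (homogenize f)) (fibre mt Dt l) (fibre mt' Dt' l)"
    using bialgebra_iso_compose[OF bialgebra_iso_compose[OF fibre_scaling_iso[OF d l] f(1)]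
        bialgebra_iso_inv[OF fibre_scaling_iso[OF d' l]]]
    by simp
qed (use d d' in \<open>simp_all add: deformation_linear linear_homogenize\<close>)

text \<open>This is the fibre over \<open>t = 0\<close> of the homogenised isomorphism onto the trivial deformation.\<close>

lemma associated_graded_iso:
  assumes d: "deformation G B mt Dt" and f: "bialgebra_iso f (fibre mt Dt 1) B" "filtered_map f"
  shows "bialgebra_iso (associated_graded f) B B"
proof -
  have "bialgebra_iso (homogenize f) (deformed B mt Dt) (deformed B (ext_map (bmult B)) (ext_map (bcomult B)))"
    using f by (intro homogenize_iso d deformation_trivial) (simp_all add: fibre_trivial)
  then have "bialgebra_iso (spec_map 0 (homogenize f)) (fibre mt Dt 0)
      (fibre (ext_map (bmult B)) (ext_map (bcomult B)) 0)"
    by (rule bialgebra_iso_specialize[rotated 2])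
      (simp_all add: deformation_linear(1) d deformation_trivial)
  then show ?thesis
    by (simp add: associated_graded_def fibre_zero[OF d] fibre_trivial)
qed

text \<open>The fibre over \<open>t = 1\<close> is a filtered coalgebra. Its comultiplication is undeformed in degree
  \<open>0\<close>, because the correction terms strictly lower the degree of \<open>B\<close>.\<close>

lemma fibre_one_comult:
  assumes d: "deformation G B mt Dt" and v: "v \<in> filtration e"
  shows "spec_map 1 Dt v \<in> vec.span (\<Union>i\<le>e. tensor_grading G i)"
    and "e = 0 \<Longrightarrow> spec_map 1 Dt v = bcomult B v"
proof -
  have hom: "homogeneous0 (poly_grading G) (poly_grading (tensor_grading G)) Dt"
    using d by (simp add: deformation_def)
  note lin = linear_spec_map[OF deformation_linear(3)[OF d], of 1]
  have "spec_map 1 Dt w \<in> vec.span (\<Union>i\<le>e. tensor_grading G i)" if w: "w \<in> G i" "i \<le> e" for w i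
  proof -
    obtain b where "\<And>j. j \<le> i \<Longrightarrow> b j \<in> tensor_grading G (i - j)"
      and "\<And>l. spec_map l Dt w = (\<Sum>j\<le>i. l ^ j *s b j)"
      using spec_map_homogeneous[OF hom subspace w(1)] by metis
    moreover from this have "b j \<in> vec.span (\<Union>i\<le>e. tensor_grading G i)" if "j \<le> i" for j
      using that w(2) by (intro vec.span_base) (auto intro!: bexI[of _ "i - j"])
    ultimately show ?thesis
      by (simp, intro vec.span_sum) simp
  qed
  then have "spec_map 1 Dt ` (\<Union>i\<le>e. G i) \<subseteq> vec.span (\<Union>i\<le>e. tensor_grading G i)"
    by auto
  then have "spec_map 1 Dt ` filtration e \<subseteq> vec.span (\<Union>i\<le>e. tensor_grading G i)"
    unfolding filtration_def vec.linear_span_image[OF linear_map_vec[OF lin], symmetric]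
    by (rule vec.span_minimal) simp
  then show "spec_map 1 Dt v \<in> vec.span (\<Union>i\<le>e. tensor_grading G i)"
    using v by blast
  show "spec_map 1 Dt v = bcomult B v" if "e = 0"
  proof -
    have "v \<in> G 0"
      using v that by (simp add: filtration_def vec.span_eq_iff[THEN iffD2, OF subspace])
    then obtain b where b: "\<And>l. spec_map l Dt v = (\<Sum>j\<le>0. l ^ j *s b j)"
      using spec_map_homogeneous[OF hom subspace, of v 0] by metis
    have "spec_map 1 Dt v = spec_map 0 Dt v"
      using b by simp
    also have "\<dots> = bcomult B v"
      by (metis fibre_simps(3) fibre_zero[OF d])
    finally show ?thesis .
  qed
qed

text \<open>Being a simple subcoalgebra is decided by the comultiplication on the subspace itself. As the
  coradical of \<open>B\<close> lies in degree \<open>0\<close>, where nothing is deformed, its simple subcoalgebras remain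
  simple subcoalgebras of the fibre.\<close>

lemma filtration_0_le_coradical:
  assumes d: "deformation G B mt Dt" and B: "coradically_graded G B"
  shows "filtration 0 \<subseteq> coradical (fibre mt Dt 1)"
proof -
  have cor: "coradical B = filtration 0"
    using B unfolding coradically_graded_def filtration_def
    by (metis coradical_filtration.simps(1))
  have sub: "subcoalgebra (fibre mt Dt 1) D \<longleftrightarrow> subcoalgebra B D" if "D \<subseteq> filtration 0" for D
  proof -
    have "spec_map 1 Dt ` D = bcomult B ` D"
      using that fibre_one_comult(2)[OF d, of _ 0] by (intro image_cong) auto
    then show ?thesis
      by (simp add: subcoalgebra_def fibre_simps)
  qed
  have "simple_subcoalgebra (fibre mt Dt 1) D" if D: "simple_subcoalgebra B D" for D
  proof -
    have "D \<subseteq> filtration 0"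
      unfolding cor[symmetric] coradical_def using D by (auto intro: vec.span_base)
    then show ?thesis
      using D sub unfolding simple_subcoalgebra_def by (meson subset_trans)
  qed
  then have "coradical B \<subseteq> coradical (fibre mt Dt 1)"
    unfolding coradical_def by (intro vec.span_mono) blast
  then show ?thesis
    by (simp add: cor)
qed

text \<open>In \<open>\<Delta>(F\<^sub>e\<^sub>+\<^sub>1) \<subseteq> \<Sum> F\<^sub>a \<otimes> F\<^sub>e\<^sub>+\<^sub>1\<^sub>-\<^sub>a\<close> the first factor lies in the coradical for \<open>a = 0\<close>, and the second
  one in \<open>F\<^sub>e\<close> for \<open>a > 0\<close>. As a consequence, an isomorphism onto \<open>B\<close> carries \<open>F\<^sub>d\<close>
  into the \<open>d\<close>th coradical filtration step of \<open>B\<close>, which is \<open>F\<^sub>d\<close> again.\<close>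

lemma filtration_le_coradical_filtration:
  assumes d: "deformation G B mt Dt" and B: "coradically_graded G B"
  shows "filtration e \<subseteq> coradical_filtration (fibre mt Dt 1) e"
proof (induction e)
  case 0
  show ?case
    using filtration_0_le_coradical[OF d B] by simp
next
  case (Suc e)
  let ?U = "fibre mt Dt 1"
  let ?S = "vec.span (tensor_subspace UNIV (coradical_filtration ?U e) \<union> tensor_subspace (coradical ?U) UNIV)"
  have F0: "filtration 0 \<subseteq> coradical ?U"
    by (rule filtration_0_le_coradical[OF d B])
  have "tensor_subspace (G a) (G (i - a)) \<subseteq> ?S" if "a \<le> i" "i \<le> Suc e" for a i
  proof (cases "a = 0")
    case True
    then have "G a \<subseteq> coradical ?U"
      using F0 homogeneous_in_filtration by blast
    then have "tensor_subspace (G a) (G (i - a)) \<subseteq> tensor_subspace (coradical ?U) UNIV"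
      by (intro tensor_subspace_mono) auto
    then show ?thesis
      using vec.span_superset by blast
  next
    case False
    then have "G (i - a) \<subseteq> filtration e"
      unfolding filtration_def using that by (intro subset_trans[OF _ vec.span_superset]) (auto intro!: bexI[of _ "i - a"])
    then have "G (i - a) \<subseteq> coradical_filtration ?U e"
      using Suc.IH by blast
    then have "tensor_subspace (G a) (G (i - a)) \<subseteq> tensor_subspace UNIV (coradical_filtration ?U e)"
      by (intro tensor_subspace_mono) auto
    then show ?thesis
      using vec.span_superset by blast
  qed
  then have "tensor_grading G i \<subseteq> ?S" if "i \<le> Suc e" for i
    unfolding tensor_grading_def using that by (intro vec.span_minimal) auto
  then have "vec.span (\<Union>i\<le>Suc e. tensor_grading G i) \<subseteq> ?S"
    by (intro vec.span_minimal) auto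
  then show ?case
    using fibre_one_comult(1)[OF d, of _ "Suc e"] by (auto simp: fibre_simps)
qed

lemma fibre_iso_filtered:
  assumes d: "deformation G B mt Dt" and B: "coradically_graded G B"
    and f: "bialgebra_iso f (fibre mt Dt 1) B"
  shows "filtered_map f"
proof -
  have "f ` filtration e \<subseteq> filtration e" for e
    using filtration_le_coradical_filtration[OF d B, of e] coradical_filtration_image[OF f, of e] B
    unfolding coradically_graded_def filtration_def by blast
  then show ?thesis
    using f by (simp add: filtered_map_def bialgebra_iso_def)
qed

text \<open>An isomorphism \<open>f\<close> onto \<open>B\<close> need not be the identity on leading terms, but its associated
  graded map is an automorphism of \<open>B\<close> and can be divided out.\<close>

lemma normalized_fibre_iso:
  assumes rigid: "rigid B" and B: "coradically_graded G B" and d: "deformation G B mt Dt"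
  obtains f where "bialgebra_iso f (fibre mt Dt 1) B" "filtered_map f"
    "associated_graded f = (\<lambda>v. v)"
proof -
  have "bialgebra (deformed B mt Dt)"
    using d by (simp add: deformation_def)
  then obtain l f0 where l: "l \<noteq> 0" and f0: "bialgebra_iso f0 (fibre mt Dt l) B"
    using rigid_generic_fibre[OF rigid _ fibre_zero[OF d]] by metis
  define f where "f = (\<lambda>v. f0 (inv (scaling l) v))"
  have f: "bialgebra_iso f (fibre mt Dt 1) B"
    unfolding f_def
    using bialgebra_iso_compose[OF bialgebra_iso_inv[OF fibre_scaling_iso[OF d l]] f0] .
  have filt: "filtered_map f"
    using d B f by (rule fibre_iso_filtered)
  let ?g = "associated_graded f"
  have g: "bialgebra_iso ?g B B"
    using d f filt by (rule associated_graded_iso)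
  have g_filt: "filtered_map ?g" and g_inv_filt: "filtered_map (inv ?g)"
    using filtered_associated_graded[OF filtered_map_linear[OF filt]] filtered_map_inv g
    by (auto simp: bialgebra_iso_def)
  have "inv ?g (?g v) = v" for v
    using g by (simp add: bialgebra_iso_def bij_is_inj)
  then have inv: "(\<lambda>v. inv ?g (?g v)) = (\<lambda>v. v)"
    by simp
  show thesis
  proof
    show "bialgebra_iso (\<lambda>v. inv ?g (f v)) (fibre mt Dt 1) B"
      using bialgebra_iso_compose[OF f bialgebra_iso_inv[OF g]] .
    show "filtered_map (\<lambda>v. inv ?g (f v))"
      using g_inv_filt filt by (rule filtered_map_compose)
    have "associated_graded (\<lambda>v. inv ?g (f v)) = (\<lambda>v. associated_graded (inv ?g) (?g v))"
      by (rule associated_graded_compose[OF g_inv_filt filt])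
    also have "\<dots> = (\<lambda>v. associated_graded (inv ?g) (associated_graded ?g v))"
      by (simp add: associated_graded_idem[OF filtered_map_linear[OF filt]])
    also have "\<dots> = associated_graded (\<lambda>v. inv ?g (?g v))"
      by (rule associated_graded_compose[OF g_inv_filt g_filt, symmetric])
    also have "\<dots> = (\<lambda>v. v)"
      unfolding inv by (rule associated_graded_id)
    finally show "associated_graded (\<lambda>v. inv ?g (f v)) = (\<lambda>v. v)" .
  qed
qed

text \<open>Comparing both fibres over \<open>t = 1\<close> with \<open>B\<close> gives a filtered isomorphism between them that is the
  identity on leading terms; its homogenisation is the required isomorphism of deformations.\<close>

lemma deformations_isomorphic:
  assumes rigid: "rigid B" and B: "coradically_graded G B"
    and d: "deformation G B mt Dt" and d': "deformation G B mt' Dt'"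
  shows "deformation_iso G B (mt, Dt) (mt', Dt')"
proof -
  obtain f where f: "bialgebra_iso f (fibre mt Dt 1) B" "filtered_map f"
    "associated_graded f = (\<lambda>v. v)"
    using normalized_fibre_iso[OF rigid B d] .
  obtain f' where f': "bialgebra_iso f' (fibre mt' Dt' 1) B" "filtered_map f'"
    "associated_graded f' = (\<lambda>v. v)"
    using normalized_fibre_iso[OF rigid B d'] .
  have bij: "bij f'"
    using f'(1) by (simp add: bialgebra_iso_def)
  then have filt: "filtered_map (inv f')"
    using f'(2) filtered_map_inv by blast
  define h where "h = (\<lambda>v. inv f' (f v))"
  have h: "bialgebra_iso h (fibre mt Dt 1) (fibre mt' Dt' 1)" "filtered_map h"
    unfolding h_def
    using bialgebra_iso_compose[OF f(1) bialgebra_iso_inv[OF f'(1)]]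
      filtered_map_compose[OF filt f(2)] by simp_all
  have "(\<lambda>v. inv f' (f' v)) = (\<lambda>v. v)"
    using bij by (simp add: bij_is_inj)
  then have "associated_graded (inv f') = (\<lambda>v. v)"
    using associated_graded_compose[OF filt f'(2)] f'(3) by (simp add: associated_graded_id)
  then have "associated_graded h = (\<lambda>v. v)"
    unfolding h_def using associated_graded_compose[OF filt f(2)] f(3) by simp
  then have "eq_mod_t (homogenize h) id"
    by (simp add: eq_mod_t_iff spec_vec_linear[OF linear_homogenize] flip: associated_graded_def)
  then show ?thesis
    unfolding deformation_iso_def
    using homogenize_iso[OF d d' h] homogenize_homogeneous[OF filtered_map_linear[OF h(2)]] by auto
qed

end

theorem corollary2p4:
  fixes B :: "('k::{alg_closed_field, field_char_0}, 'n::finite) bialg"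
    and G :: "nat \<Rightarrow> ('k ^ 'n) set"
  assumes "graded_bialgebra G B"
    and "rigid B"
    and "coradically_graded G B"
  shows "graded_rigid G B"
proof -
  interpret graded_bialg G B
    by unfold_locales (use assms(1) in \<open>simp_all add: graded_bialgebra_def\<close>)
  let ?D = "{(mt, Dt). deformation G B mt Dt}"
  let ?R = "{(d, d'). case_prod (deformation G B) d \<and> case_prod (deformation G B) d' \<and>
    deformation_iso G B d d'}"
  have "(ext_map (bmult B), ext_map (bcomult B)) \<in> ?D"
    using deformation_trivial by simp
  moreover have "?R `` {d} = ?D" if "d \<in> ?D" for d
    using that deformations_isomorphic[OF assms(2,3)] by auto
  ultimately have "?D // ?R = {?D}"
    unfolding quotient_def by auto
  then show ?thesis
    unfolding graded_rigid_def by (auto simp: is_singleton_def)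
qed

end
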